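(* Let $W\subset\mathbb H$ be open and let $U$ be a slice Cauchy domain with $\overline U\subset W$. Let $J\in\mathbb S$ and $ds_J=ds(-J)$. (1) If $f$ is left slice hyperholomorphic on $W$, then $\tilde f(q)=\mathcal D f(q)$ is harmonic and $$\tilde f(q)=-\frac1\pi\int_{\partial(U\cap\mathbb C_J)}\mathcal Q_{c,s}(q)^{-1}\,ds_J\,f(s),\qquad q\in U.$$ (2) If $f$ is right slice hyperholomorphic on $W$, then $\tilde f(q)=f(q)\mathcal D$ is harmonic and $$\tilde f(q)=-\frac1\pi\int_{\partial(U\cap\mathbb C_J)}f(s)\,ds_J\,\mathcal Q_{c,s}(q)^{-1},\qquad q\in U.$$ The integrals depend neither on $U$ nor on $J\in\mathbb S$.
   Context: $\mathbb H$ denotes the quaternions; for $q=q_0+\underline q$, $\Re(q)=q_0$, $|q|$ its modulus; $\mathbb S$ is the unit sphere of purely imaginary quaternions and $\mathbb C_J=\{u+Jv:u,v\in\mathbb R\}$. $\mathcal Q_{c,s}(q)^{-1}:=(s^2-2\Re(q)s+|q|^2)^{-1}$. A set is axially symmetric if with $u+Iv$ it contains all $u+Jv$, $J\in\mathbb S$. A slice Cauchy domain is an axially symmetric open set $U$ such that for every $J\in\mathbb S$ the boundary of $U\cap\mathbb C_J$ is a union of finitely many nonintersecting piecewise continuously differentiable Jordan curves; boundary integrals are over the positively oriented boundary, with $ds_J=ds(-J)$. On an axially symmetric open set, $f$ is left (resp. right) slice hyperholomorphic if $f(u+Jv)=\alpha(u,v)+J\beta(u,v)$ (resp. $\alpha(u,v)+\beta(u,v)J$)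 for all $J\in\mathbb S$, with $\alpha,\beta$ $\mathbb H$-valued differentiable, $\alpha(u,-v)=\alpha(u,v)$, $\beta(u,-v)=-\beta(u,v)$, and $\partial_u\alpha-\partial_v\beta=0$, $\partial_v\alpha+\partial_u\beta=0$. The Fueter operator acts as $\mathcal Dg=\partial_{q_0}g+\sum_{i=1}^3e_i\partial_{q_i}g$ and $g\mathcal D=\partial_{q_0}g+\sum_{i=1}^3\partial_{q_i}g\,e_i$.
   Formalization: The slice Cauchy domain U is assumed bounded, with positive orientation meaning total winding number 1 on U∩C_J and 0 outside its closure; for unbounded U the formula fails, e.g. f(s)=s on the complement of a closed ball gives Df=-2 while the integral is 0. *)

theory Defs
  imports "HOL-Complex_Analysis.Complex_Analysis"
begin

text \<open>A quaternion q = q0 + q1 e1 + q2 e2 + q3 e3 is represented by the tuple (q0,q1,q2,q3).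
  The product type carries the real vector space structure and the Euclidean norm
  sqrt(q0^2+q1^2+q2^2+q3^2) = |q|; the Hamilton product is defined below.\<close>

type_synonym quat = "real \<times> real \<times> real \<times> real"

definition qmult :: "quat \<Rightarrow> quat \<Rightarrow> quat" (infixl "\<odot>" 70) where
  "qmult p q = (case p of (a0,a1,a2,a3) \<Rightarrow> case q of (b0,b1,b2,b3) \<Rightarrow>
     (a0*b0 - a1*b1 - a2*b2 - a3*b3,
      a0*b1 + a1*b0 + a2*b3 - a3*b2,
      a0*b2 - a1*b3 + a2*b0 + a3*b1,
      a0*b3 + a1*b2 - a2*b1 + a3*b0))"

definition qRe :: "quat \<Rightarrow> real" where "qRe q = fst q"

definition qreal :: "real \<Rightarrow> quat" where "qreal r = (r, 0, 0, 0)"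

definition qconj :: "quat \<Rightarrow> quat" where
  "qconj q = (case q of (a0,a1,a2,a3) \<Rightarrow> (a0, -a1, -a2, -a3))"

definition qinv :: "quat \<Rightarrow> quat" where
  "qinv q = (1 / (norm q)\<^sup>2) *\<^sub>R qconj q"

definition qe :: "nat \<Rightarrow> quat" where
  "qe i = (if i = 0 then (1,0,0,0) else if i = 1 then (0,1,0,0)
           else if i = 2 then (0,0,1,0) else (0,0,0,1))"

definition qsphere :: "quat set" where
  "qsphere = {J. qRe J = 0 \<and> norm J = 1}"

definition slice_pt :: "real \<Rightarrow> real \<Rightarrow> quat \<Rightarrow> quat" where
  "slice_pt u v J = qreal u + v *\<^sub>R J"

definition embJ :: "quat \<Rightarrow> complex \<Rightarrow> quat" where
  "embJ J z = slice_pt (Re z) (Im z) J"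

definition axially_symmetric :: "quat set \<Rightarrow> bool" where
  "axially_symmetric A \<longleftrightarrow>
     (\<forall>u v I J. I \<in> qsphere \<longrightarrow> J \<in> qsphere \<longrightarrow> slice_pt u v I \<in> A \<longrightarrow> slice_pt u v J \<in> A)"

definition Qcs :: "quat \<Rightarrow> quat \<Rightarrow> quat" where
  "Qcs q s = s \<odot> s - (2 * qRe q) *\<^sub>R s + qreal ((norm q)\<^sup>2)"

definition slice_dom :: "quat set \<Rightarrow> (real \<times> real) set" where
  "slice_dom W = {(u, v). \<exists>J\<in>qsphere. slice_pt u v J \<in> W}"

definition slice_stem_ok :: "quat set \<Rightarrow> (real \<times> real \<Rightarrow> quat) \<Rightarrow> (real \<times> real \<Rightarrow> quat) \<Rightarrow> bool" where
  "slice_stem_ok W \<alpha> \<beta> \<longleftrightarrow>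
     (\<forall>u v. (u, v) \<in> slice_dom W \<longrightarrow> \<alpha> (u, -v) = \<alpha> (u, v) \<and> \<beta> (u, -v) = - \<beta> (u, v)) \<and>
     (\<forall>z \<in> slice_dom W. \<exists>\<alpha>' \<beta>'. (\<alpha> has_derivative \<alpha>') (at z) \<and> (\<beta> has_derivative \<beta>') (at z) \<and>
          \<alpha>' (1, 0) - \<beta>' (0, 1) = 0 \<and> \<alpha>' (0, 1) + \<beta>' (1, 0) = 0)"

definition left_slice_hh :: "quat set \<Rightarrow> (quat \<Rightarrow> quat) \<Rightarrow> bool" where
  "left_slice_hh W f \<longleftrightarrow> open W \<and> axially_symmetric W \<and>
     (\<exists>\<alpha> \<beta>. slice_stem_ok W \<alpha> \<beta> \<and>
        (\<forall>u v J. J \<in> qsphere \<longrightarrow> slice_pt u v J \<in> W \<longrightarrow>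
            f (slice_pt u v J) = \<alpha> (u, v) + J \<odot> \<beta> (u, v)))"

definition right_slice_hh :: "quat set \<Rightarrow> (quat \<Rightarrow> quat) \<Rightarrow> bool" where
  "right_slice_hh W f \<longleftrightarrow> open W \<and> axially_symmetric W \<and>
     (\<exists>\<alpha> \<beta>. slice_stem_ok W \<alpha> \<beta> \<and>
        (\<forall>u v J. J \<in> qsphere \<longrightarrow> slice_pt u v J \<in> W \<longrightarrow>
            f (slice_pt u v J) = \<alpha> (u, v) + \<beta> (u, v) \<odot> J))"

definition pd :: "nat \<Rightarrow> (quat \<Rightarrow> quat) \<Rightarrow> quat \<Rightarrow> quat" where
  "pd i g q = frechet_derivative g (at q) (qe i)"

definition fueter_left :: "(quat \<Rightarrow> quat) \<Rightarrow> quat \<Rightarrow> quat" where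
  "fueter_left g q = pd 0 g q + qe 1 \<odot> pd 1 g q + qe 2 \<odot> pd 2 g q + qe 3 \<odot> pd 3 g q"

definition fueter_right :: "(quat \<Rightarrow> quat) \<Rightarrow> quat \<Rightarrow> quat" where
  "fueter_right g q = pd 0 g q + pd 1 g q \<odot> qe 1 + pd 2 g q \<odot> qe 2 + pd 3 g q \<odot> qe 3"

definition harmonic_on :: "quat set \<Rightarrow> (quat \<Rightarrow> quat) \<Rightarrow> bool" where
  "harmonic_on S g \<longleftrightarrow>
     (\<forall>q\<in>S. g differentiable (at q) \<and> (\<forall>i<4. (pd i g) differentiable (at q))) \<and>
     (\<forall>i<4. \<forall>j<4. continuous_on S (pd i (pd j g))) \<and>
     (\<forall>q\<in>S. (\<Sum>i<4. pd i (pd i g) q) = 0)"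

definition slice_part :: "quat set \<Rightarrow> quat \<Rightarrow> complex set" where
  "slice_part U J = {z. embJ J z \<in> U}"

definition jordan_boundary :: "quat set \<Rightarrow> quat \<Rightarrow> (real \<Rightarrow> complex) list \<Rightarrow> bool" where
  "jordan_boundary U J \<Gamma> \<longleftrightarrow>
     (\<forall>\<gamma>\<in>set \<Gamma>. valid_path \<gamma> \<and> simple_path \<gamma> \<and> pathfinish \<gamma> = pathstart \<gamma>) \<and>
     (\<forall>i<length \<Gamma>. \<forall>j<length \<Gamma>. i \<noteq> j \<longrightarrow> path_image (\<Gamma>!i) \<inter> path_image (\<Gamma>!j) = {}) \<and>
     (\<Union>\<gamma>\<in>set \<Gamma>. path_image \<gamma>) = frontier (slice_part U J)"

text \<open>Positive orientation (U \<inter> C_J to the left), expressed by winding numbers.\<close>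
definition pos_oriented_boundary :: "quat set \<Rightarrow> quat \<Rightarrow> (real \<Rightarrow> complex) list \<Rightarrow> bool" where
  "pos_oriented_boundary U J \<Gamma> \<longleftrightarrow> jordan_boundary U J \<Gamma> \<and>
     (\<forall>z. z \<notin> frontier (slice_part U J) \<longrightarrow>
        (\<Sum>\<gamma>\<leftarrow>\<Gamma>. winding_number \<gamma> z) = (if z \<in> slice_part U J then 1 else 0))"

definition slice_cauchy_domain :: "quat set \<Rightarrow> bool" where
  "slice_cauchy_domain U \<longleftrightarrow> open U \<and> axially_symmetric U \<and>
     (\<forall>J\<in>qsphere. \<exists>\<Gamma>. jordan_boundary U J \<Gamma>)"

definition bdry_int_left :: "(real \<Rightarrow> complex) list \<Rightarrow> quat \<Rightarrow> (quat \<Rightarrow> quat) \<Rightarrow> quat \<Rightarrow> quat" where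
  "bdry_int_left \<Gamma> J f q = (\<Sum>\<gamma>\<leftarrow>\<Gamma>. integral {0..1} (\<lambda>t.
      qinv (Qcs q (embJ J (\<gamma> t))) \<odot> (embJ J (vector_derivative \<gamma> (at t)) \<odot> (- J)) \<odot> f (embJ J (\<gamma> t))))"

definition bdry_int_right :: "(real \<Rightarrow> complex) list \<Rightarrow> quat \<Rightarrow> (quat \<Rightarrow> quat) \<Rightarrow> quat \<Rightarrow> quat" where
  "bdry_int_right \<Gamma> J f q = (\<Sum>\<gamma>\<leftarrow>\<Gamma>. integral {0..1} (\<lambda>t.
      f (embJ J (\<gamma> t)) \<odot> (embJ J (vector_derivative \<gamma> (at t)) \<odot> (- J)) \<odot> qinv (Qcs q (embJ J (\<gamma> t)))))"

end

theory Submission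
  imports Defs
begin

text \<open>
  Let \<open>F\<^sub>i = \<alpha>\<^sub>i + \<i> \<beta>\<^sub>i\<close> be the real components of a stem. They are holomorphic and commute with
  complex conjugation. For \<open>q\<close> with real part \<open>x\<close> and imaginary part of length \<open>r\<close> one has
  \<open>s\<^sup>2 - 2 x s + |q|\<^sup>2 = (s - z) (s - cnj z)\<close> with \<open>z = x + \<i> r\<close>, so Cauchy's formula evaluates the
  boundary integral to \<open>2 pi \<beta> (x, r) / r\<close>. On the other hand, representing \<open>\<alpha>\<close> and \<open>\<beta> / r\<close>
  near a point by integrals over small circles and differentiating under the integral sign shows
  that \<open>\<beta> / r\<close> is harmonic, also across the real axis, and that the Fueter operator maps the
  function with this stem to \<open>- 2 \<beta> / r\<close>.
\<close>

section \<open>Cauchy's theorem for cycles\<close>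

text \<open>Three obstacles shape the proof. The boundary of a slice is a list of loops, and the
  slice of \<open>U\<close> may be disconnected: if \<open>U\<close> misses the real axis, its slice
  splits into mirror images in the two half planes. Cauchy's theorem is therefore needed for sums of
  loops in arbitrary open sets. The radius r is not differentiable on the real axis, so \<beta>/r
  cannot be differentiated there by the chain rule. But s^2 - 2 x s + |q|^2 is a polynomial in the
  coordinates of q; with the path fixed and only this kernel differentiated, real and nonreal points
  are treated alike. Small circles are used for this because harmonicity is claimed on all of
  \<open>W\<close>, where no boundary cycle is given. Quaternions do not commute. After splitting
  the stem into real components, all factors of the integrand lie in one slice, except for a
  constant basis element standing at its end. Both sides of the formula reduce to multiples of
  \<beta>(x, r) / r, which mentions neither \<open>U\<close> nor \<open>J\<close>: this is the
  claimed independence.\<close>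

lemma eventually_winding_sum_eq:
  assumes "\<And>\<gamma>. \<gamma> \<in> set \<Gamma> \<Longrightarrow> path \<gamma> \<and> pathfinish \<gamma> = pathstart \<gamma> \<and> z \<notin> path_image \<gamma>"
  shows "eventually (\<lambda>w. (\<Sum>\<gamma>\<leftarrow>\<Gamma>. winding_number \<gamma> w) = (\<Sum>\<gamma>\<leftarrow>\<Gamma>. winding_number \<gamma> z)) (nhds z)"
  using assms
proof (induction \<Gamma>)
  case (Cons \<gamma> \<Gamma>)
  let ?L = "{w. w \<notin> path_image \<gamma> \<and> winding_number \<gamma> w = winding_number \<gamma> z}"
  have "eventually (\<lambda>w. w \<in> ?L) (nhds z)"
    using Cons.prems by (intro eventually_nhds_in_open open_winding_number_levelsets) auto
  moreover have "eventually (\<lambda>w. (\<Sum>\<gamma>\<leftarrow>\<Gamma>. winding_number \<gamma> w) = (\<Sum>\<gamma>\<leftarrow>\<Gamma>. winding_number \<gamma> z)) (nhds z)"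
    using Cons by auto
  ultimately show ?case
    by eventually_elim simp
qed auto

lemma eventually_winding_sum_0:
  assumes "\<And>\<gamma>. \<gamma> \<in> set \<Gamma> \<Longrightarrow> path \<gamma> \<and> pathfinish \<gamma> = pathstart \<gamma>"
  shows "eventually (\<lambda>w. (\<Sum>\<gamma>\<leftarrow>\<Gamma>. winding_number \<gamma> w) = 0) at_infinity"
  using assms
proof (induction \<Gamma>)
  case (Cons \<gamma> \<Gamma>)
  have "eventually (\<lambda>w. winding_number \<gamma> w = 0) at_infinity"
    using winding_number_zero_at_infinity[of \<gamma>] Cons.prems by (auto simp: eventually_at_infinity)
  moreover have "eventually (\<lambda>w. (\<Sum>\<gamma>\<leftarrow>\<Gamma>. winding_number \<gamma> w) = 0) at_infinity"
    using Cons by auto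
  ultimately show ?case
    by eventually_elim simp
qed auto

lemma sum_list_filter_partition:
  fixes f :: "'a \<Rightarrow> 'b :: comm_monoid_add"
  shows "(\<Sum>x\<leftarrow>xs. f x) = (\<Sum>x\<leftarrow>filter P xs. f x) + (\<Sum>x\<leftarrow>filter (\<lambda>x. \<not> P x) xs. f x)"
  by (induction xs) (auto simp: algebra_simps)

text \<open>The function equal to the winding sum of the loops in \<open>C\<close> off \<open>C\<close>, and to minus the winding
  sum of the other loops on \<open>C\<close>, is locally constant on the plane and vanishes near infinity.\<close>
lemma winding_sum_component:
  assumes "open S" and C: "C \<in> components S" and "z \<notin> C"
    and \<Gamma>: "\<And>\<gamma>. \<gamma> \<in> set \<Gamma> \<Longrightarrow> path \<gamma> \<and> pathfinish \<gamma> = pathstart \<gamma> \<and> path_image \<gamma> \<subseteq> S"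
    and zero: "\<And>z. z \<notin> S \<Longrightarrow> (\<Sum>\<gamma>\<leftarrow>\<Gamma>. winding_number \<gamma> z) = 0"
  shows "(\<Sum>\<gamma>\<leftarrow>filter (\<lambda>\<gamma>. path_image \<gamma> \<subseteq> C) \<Gamma>. winding_number \<gamma> z) = 0"
proof -
  define A where "A w = (\<Sum>\<gamma>\<leftarrow>filter (\<lambda>\<gamma>. path_image \<gamma> \<subseteq> C) \<Gamma>. winding_number \<gamma> w)" for w
  define B where "B w = (\<Sum>\<gamma>\<leftarrow>filter (\<lambda>\<gamma>. \<not> path_image \<gamma> \<subseteq> C) \<Gamma>. winding_number \<gamma> w)" for w
  have AB: "A w + B w = (\<Sum>\<gamma>\<leftarrow>\<Gamma>. winding_number \<gamma> w)" for w
    unfolding A_def B_def by (rule sum_list_filter_partition[symmetric])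
  have "open C"
    using C \<open>open S\<close> open_components by blast
  have disj: "path_image \<gamma> \<inter> C = {}" if "\<gamma> \<in> set \<Gamma>" "\<not> path_image \<gamma> \<subseteq> C" for \<gamma>
    using components_maximal[OF C, of "path_image \<gamma>"] that \<Gamma>[OF that(1)] connected_path_image by blast
  have evA: "eventually (\<lambda>x. A x = A w) (nhds w)" if "w \<notin> C" for w
    unfolding A_def using that \<Gamma> by (intro eventually_winding_sum_eq) auto
  have evB: "eventually (\<lambda>x. B x = B w) (nhds w)" if "w \<in> C" for w
    unfolding B_def using that \<Gamma> disj by (intro eventually_winding_sum_eq) auto
  define \<phi> where "\<phi> w = (if w \<in> C then - B w else A w)" for w
  have loc: "eventually (\<lambda>x. \<phi> w = \<phi> x) (nhds w)" for w
  proof -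
    consider "w \<in> C" | "w \<in> S" "w \<notin> C" | "w \<notin> S"
      by blast
    then show ?thesis
    proof cases
      case 1
      have "eventually (\<lambda>x. x \<in> C) (nhds w)"
        using 1 \<open>open C\<close> by (rule eventually_nhds_in_open[rotated])
      with evB[OF 1] show ?thesis
        by eventually_elim (simp add: \<phi>_def 1)
    next
      case 2
      obtain D where D: "D \<in> components S" "w \<in> D"
        using 2 by (metis UnionE Union_components)
      then have "C \<inter> D = {}"
        using 2 C components_nonoverlap by blast
      have "eventually (\<lambda>x. x \<in> D) (nhds w)"
        using D \<open>open S\<close> open_components by (intro eventually_nhds_in_open) auto
      with evA[OF 2(2)] show ?thesis
        by eventually_elim (use \<open>C \<inter> D = {}\<close> in \<open>auto simp: \<phi>_def 2\<close>)
    next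
      \<comment> \<open>A point outside \<open>S\<close> may lie on the boundary of
        \<open>C\<close>. The total winding sum is 0 there and locally constant, so nearby
        \<open>A = - B\<close> and the two branches of \<open>\<phi>\<close> agree.\<close>
      case 3
      then have "w \<notin> C"
        using C in_components_subset by blast
      have "eventually (\<lambda>x. (\<Sum>\<gamma>\<leftarrow>\<Gamma>. winding_number \<gamma> x) = (\<Sum>\<gamma>\<leftarrow>\<Gamma>. winding_number \<gamma> w)) (nhds w)"
        using 3 \<Gamma> by (intro eventually_winding_sum_eq) auto
      with evA[OF \<open>w \<notin> C\<close>] show ?thesis
      proof eventually_elim
        case (elim x)
        then have "A x + B x = 0"
          using AB[of x] zero[OF 3] by metis
        with elim show ?case
          using \<open>w \<notin> C\<close> by (simp add: \<phi>_def add_eq_0_iff2)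
      qed
    qed
  qed
  \<comment> \<open>A far point makes both sums vanish, so \<open>\<phi>\<close> is 0 there
    whichever branch applies.\<close>
  have "eventually (\<lambda>w. A w = 0 \<and> B w = 0) at_infinity"
    unfolding A_def B_def eventually_conj_iff
    using \<Gamma> by (intro conjI eventually_winding_sum_0) auto
  then obtain w where w: "A w = 0" "B w = 0"
    using eventually_happens trivial_limit_at_infinity by blast
  have "\<phi> z = \<phi> w"
    by (rule connected_local_const[of UNIV]) (use loc in \<open>auto simp: eventually_nhds_conv_at\<close>)
  then show ?thesis
    using w \<open>z \<notin> C\<close> by (simp add: \<phi>_def A_def split: if_splits)
qed

text \<open>Each connecting path \<open>p\<close> is traversed out and back, so it contributes
  nothing to the integral. This turns a cycle in a connected open set into one closed path, the form
  that \<open>Cauchy_theorem_global\<close> accepts.\<close>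

lemma join_loops:
  assumes "open S" "connected S" "\<Gamma> \<noteq> []"
    and "\<And>\<gamma>. \<gamma> \<in> set \<Gamma> \<Longrightarrow> valid_path \<gamma> \<and> pathfinish \<gamma> = pathstart \<gamma> \<and> path_image \<gamma> \<subseteq> S"
  shows "\<exists>g. valid_path g \<and> pathfinish g = pathstart g \<and> path_image g \<subseteq> S \<and>
           (\<forall>f. f holomorphic_on S \<longrightarrow> contour_integral g f = (\<Sum>\<gamma>\<leftarrow>\<Gamma>. contour_integral \<gamma> f))"
  using assms(3,4)
proof (induction \<Gamma> rule: list_nonempty_induct)
  case (single \<gamma>)
  then show ?case by auto
next
  case (cons \<gamma> \<Gamma>)
  obtain g where g: "valid_path g" "pathfinish g = pathstart g" "path_image g \<subseteq> S"
    "\<And>f. f holomorphic_on S \<Longrightarrow> contour_integral g f = (\<Sum>\<gamma>\<leftarrow>\<Gamma>. contour_integral \<gamma> f)"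
    using cons by (metis list.set_intros(2))
  have \<gamma>: "valid_path \<gamma>" "pathfinish \<gamma> = pathstart \<gamma>" "path_image \<gamma> \<subseteq> S"
    using cons.prems by auto
  obtain p where p: "polynomial_function p" "path_image p \<subseteq> S"
      "pathstart p = pathstart \<gamma>" "pathfinish p = pathstart g"
    using connected_open_polynomial_connected[OF assms(1,2), of "pathstart \<gamma>" "pathstart g"]
      g(3) \<gamma>(3) by (meson pathstart_in_path_image subsetD)
  have vp: "valid_path p"
    using p(1) by (rule valid_path_polynomial_function)
  have "contour_integral (\<gamma> +++ p +++ g +++ reversepath p) f
      = (\<Sum>\<gamma>\<leftarrow>\<gamma> # \<Gamma>. contour_integral \<gamma> f)" if f: "f holomorphic_on S" for f
  proof -
    have int: "f contour_integrable_on \<gamma>" "f contour_integrable_on p" "f contour_integrable_on g"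
      using f \<gamma> p g vp \<open>open S\<close> contour_integrable_holomorphic_simple by blast+
    then show ?thesis
      using \<gamma> p g vp f
      by (simp add: contour_integral_reversepath contour_integrable_reversepath)
  qed
  moreover have "path_image (\<gamma> +++ p +++ g +++ reversepath p) \<subseteq> S"
    using \<gamma> p g by (simp add: path_image_join)
  ultimately show ?case
    using \<gamma> p g vp by (intro exI[of _ "\<gamma> +++ p +++ g +++ reversepath p"]) (auto intro!: valid_path_join)
qed

text \<open>Loops can be joined only within one component \<open>C\<close>. By
  \<open>winding_sum_component\<close> the loops in \<open>C\<close> have winding sum 0 about every
  point off \<open>C\<close>, so removing them preserves the hypothesis for the remaining list,
  which is shorter.\<close>

theorem Cauchy_theorem_cycle:
  assumes "open S" and f: "f holomorphic_on S"
    and "\<And>\<gamma>. \<gamma> \<in> set \<Gamma> \<Longrightarrow> valid_path \<gamma> \<and> pathfinish \<gamma> = pathstart \<gamma> \<and> path_image \<gamma> \<subseteq> S"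
    and "\<And>z. z \<notin> S \<Longrightarrow> (\<Sum>\<gamma>\<leftarrow>\<Gamma>. winding_number \<gamma> z) = 0"
  shows "(\<Sum>\<gamma>\<leftarrow>\<Gamma>. contour_integral \<gamma> f) = 0"
  using assms(3,4)
proof (induction \<Gamma> rule: length_induct)
  case (1 \<Gamma>)
  show ?case
  proof (cases \<Gamma>)
    case (Cons \<gamma>\<^sub>0 \<Gamma>\<^sub>0)
    have "pathstart \<gamma>\<^sub>0 \<in> S"
      using 1(2) Cons by (metis list.set_intros(1) pathstart_in_path_image subsetD)
    then obtain C where C: "C \<in> components S" "pathstart \<gamma>\<^sub>0 \<in> C"
      by (metis UnionE Union_components)
    define \<Delta> where "\<Delta> = filter (\<lambda>\<gamma>. path_image \<gamma> \<subseteq> C) \<Gamma>"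
    define \<Lambda> where "\<Lambda> = filter (\<lambda>\<gamma>. \<not> path_image \<gamma> \<subseteq> C) \<Gamma>"
    have "path_image \<gamma>\<^sub>0 \<subseteq> C"
      using components_maximal[OF C(1), of "path_image \<gamma>\<^sub>0"] C(2) 1(2)[of \<gamma>\<^sub>0] Cons
        connected_path_image valid_path_imp_path pathstart_in_path_image by fastforce
    then have \<gamma>\<^sub>0: "\<gamma>\<^sub>0 \<in> set \<Delta>"
      by (simp add: \<Delta>_def Cons)
    have CS: "open C" "connected C" "C \<subseteq> S"
      using C \<open>open S\<close> open_components in_components_connected in_components_subset by blast+
    have wC: "(\<Sum>\<gamma>\<leftarrow>\<Delta>. winding_number \<gamma> z) = 0" if "z \<notin> C" for z
      unfolding \<Delta>_def using 1(2,3) that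
      by (intro winding_sum_component[OF \<open>open S\<close> C(1)]) (auto simp: valid_path_imp_path)
    have "(\<Sum>\<gamma>\<leftarrow>\<Lambda>. winding_number \<gamma> z) = 0" if "z \<notin> S" for z
      using 1(3)[OF that] wC[OF contra_subsetD[OF CS(3) that]]
        sum_list_filter_partition[of "\<lambda>\<gamma>. winding_number \<gamma> z" \<Gamma> "\<lambda>\<gamma>. path_image \<gamma> \<subseteq> C"]
      by (auto simp: \<Delta>_def \<Lambda>_def)
    moreover have "length \<Lambda> < length \<Gamma>"
      unfolding \<Lambda>_def using \<gamma>\<^sub>0 by (intro length_filter_less[of \<gamma>\<^sub>0]) (auto simp: \<Delta>_def)
    ultimately have \<Lambda>: "(\<Sum>\<gamma>\<leftarrow>\<Lambda>. contour_integral \<gamma> f) = 0"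
      using 1(1,2) by (auto simp: \<Lambda>_def)
    have \<Delta>: "valid_path \<gamma> \<and> pathfinish \<gamma> = pathstart \<gamma> \<and> path_image \<gamma> \<subseteq> C" if "\<gamma> \<in> set \<Delta>" for \<gamma>
      using that 1(2) by (auto simp: \<Delta>_def)
    obtain g where g: "valid_path g" "pathfinish g = pathstart g" "path_image g \<subseteq> C"
      "\<And>f. f holomorphic_on C \<Longrightarrow> contour_integral g f = (\<Sum>\<gamma>\<leftarrow>\<Delta>. contour_integral \<gamma> f)"
      using join_loops[OF CS(1,2), of \<Delta>] \<gamma>\<^sub>0 \<Delta> by force
    \<comment> \<open>A winding number about a point off \<open>C\<close> is the integral of a
      function holomorphic on \<open>C\<close>, so the joined path inherits the winding sum of the
      loops.\<close>
    have "winding_number g z = 0" if "z \<notin> C" for z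
    proof -
      have "winding_number g z = 1 / (2*pi*\<i>) * contour_integral g (\<lambda>w. 1 / (w - z))"
        using g that by (intro winding_number_valid_path) auto
      also have "contour_integral g (\<lambda>w. 1 / (w - z)) = (\<Sum>\<gamma>\<leftarrow>\<Delta>. contour_integral \<gamma> (\<lambda>w. 1 / (w - z)))"
        using that by (intro g(4) holomorphic_intros) auto
      also have "1 / (2*pi*\<i>) * \<dots> = (\<Sum>\<gamma>\<leftarrow>\<Delta>. winding_number \<gamma> z)"
        unfolding sum_list_const_mult[symmetric]
        by (rule arg_cong[of _ _ sum_list], rule map_cong[OF refl], subst winding_number_valid_path)
           (use \<Delta> that in auto)
      finally show ?thesis
        using wC[OF that] by simp
    qed
    then have "contour_integral g f = 0"
      using Cauchy_theorem_global[of C f g] g CS f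
      by (meson contour_integral_unique holomorphic_on_subset)
    then have "(\<Sum>\<gamma>\<leftarrow>\<Delta>. contour_integral \<gamma> f) = 0"
      using g(4) f CS(3) holomorphic_on_subset by metis
    then show ?thesis
      using \<Lambda> sum_list_filter_partition[of "\<lambda>\<gamma>. contour_integral \<gamma> f" \<Gamma> "\<lambda>\<gamma>. path_image \<gamma> \<subseteq> C"]
      by (simp add: \<Delta>_def \<Lambda>_def)
  qed simp
qed

text \<open>Splitting off \<open>f z / (w - z)\<close> leaves the difference quotient of
  \<open>f\<close>, whose singularity at \<open>z\<close> is removable; Cauchy's theorem for cycles
  kills it, and the split-off term counts windings.\<close>

theorem Cauchy_integral_formula_cycle:
  assumes "open S" and f: "f holomorphic_on S" and "z \<in> S"
    and \<Gamma>: "\<And>\<gamma>. \<gamma> \<in> set \<Gamma> \<Longrightarrow> valid_path \<gamma> \<and> pathfinish \<gamma> = pathstart \<gamma> \<and> path_image \<gamma> \<subseteq> S - {z}"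
    and zero: "\<And>z. z \<notin> S \<Longrightarrow> (\<Sum>\<gamma>\<leftarrow>\<Gamma>. winding_number \<gamma> z) = 0"
  shows "(\<Sum>\<gamma>\<leftarrow>\<Gamma>. contour_integral \<gamma> (\<lambda>w. f w / (w - z))) = 2 * pi * \<i> * (\<Sum>\<gamma>\<leftarrow>\<Gamma>. winding_number \<gamma> z) * f z"
proof -
  let ?d = "\<lambda>w. if w = z then deriv f z else (f w - f z) / (w - z)"
  have d: "?d holomorphic_on S"
    by (rule pole_lemma_open[OF f \<open>open S\<close>])
  have "contour_integral \<gamma> (\<lambda>w. f w / (w - z)) = contour_integral \<gamma> ?d + 2 * pi * \<i> * f z * winding_number \<gamma> z"
    if "\<gamma> \<in> set \<Gamma>" for \<gamma>
  proof -
    note g = \<Gamma>[OF that]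
    have "?d contour_integrable_on \<gamma>"
      using g by (intro contour_integrable_holomorphic_simple[OF d \<open>open S\<close>]) auto
    then have "(?d has_contour_integral contour_integral \<gamma> ?d) \<gamma>"
      by (rule has_contour_integral_integral)
    moreover have "((\<lambda>w. f z * (1 / (w - z))) has_contour_integral f z * (2 * pi * \<i> * winding_number \<gamma> z)) \<gamma>"
      using g by (intro has_contour_integral_lmul has_contour_integral_winding_number) auto
    ultimately have "((\<lambda>w. ?d w + f z * (1 / (w - z))) has_contour_integral
        contour_integral \<gamma> ?d + f z * (2 * pi * \<i> * winding_number \<gamma> z)) \<gamma>"
      by (rule has_contour_integral_add)
    then have "((\<lambda>w. f w / (w - z)) has_contour_integral
        contour_integral \<gamma> ?d + f z * (2 * pi * \<i> * winding_number \<gamma> z)) \<gamma>"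
      by (rule has_contour_integral_eq) (use g in \<open>auto simp: divide_simps\<close>)
    then show ?thesis
      by (simp add: contour_integral_unique)
  qed
  then have "(\<Sum>\<gamma>\<leftarrow>\<Gamma>. contour_integral \<gamma> (\<lambda>w. f w / (w - z)))
      = (\<Sum>\<gamma>\<leftarrow>\<Gamma>. contour_integral \<gamma> ?d + 2 * pi * \<i> * f z * winding_number \<gamma> z)"
    by (intro arg_cong[of _ _ sum_list] map_cong) auto
  also have "\<dots> = (\<Sum>\<gamma>\<leftarrow>\<Gamma>. contour_integral \<gamma> ?d) + 2 * pi * \<i> * f z * (\<Sum>\<gamma>\<leftarrow>\<Gamma>. winding_number \<gamma> z)"
    by (simp add: sum_list_addf sum_list_const_mult)
  also have "(\<Sum>\<gamma>\<leftarrow>\<Gamma>. contour_integral \<gamma> ?d) = 0"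
    by (rule Cauchy_theorem_cycle[OF \<open>open S\<close> d]) (use \<Gamma> zero in auto)
  finally show ?thesis
    by (simp add: mult_ac)
qed

section \<open>Differentiation under the integral sign\<close>

text \<open>This is s^2 - 2 x s + |q|^2 with the square completed. The inner product in place of a
  norm makes it visibly polynomial in the coordinates of \<open>q\<close>, hence smooth across the
  real axis.\<close>

definition slice_den :: "quat \<Rightarrow> complex \<Rightarrow> complex" where
  "slice_den q s = (s - of_real (fst q))\<^sup>2 + of_real (snd q \<bullet> snd q)"

text \<open>The two exponents make the family closed, up to linear combination with coefficients
  polynomial in \<open>q\<close>, under differentiation in \<open>q\<close>.\<close>

definition slice_ker :: "nat \<Rightarrow> nat \<Rightarrow> quat \<Rightarrow> complex \<Rightarrow> complex" where
  "slice_ker j k q s = (s - of_real (fst q)) ^ j * inverse (slice_den q s) ^ k"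

text \<open>The weight \<open>\<omega>\<close> will be a holomorphic function along
  \<open>\<gamma>\<close> times the velocity of \<open>\<gamma>\<close>, so that a moment is a
  contour integral. All dependence on \<open>q\<close> sits in the kernel.\<close>

definition moment :: "(real \<Rightarrow> complex) \<Rightarrow> (real \<Rightarrow> complex) \<Rightarrow> nat \<Rightarrow> nat \<Rightarrow> quat \<Rightarrow> complex" where
  "moment \<gamma> \<omega> j k q = integral {0..1} (\<lambda>t. slice_ker j k q (\<gamma> t) * \<omega> t)"

lemma slice_den_has_derivative:
  "((\<lambda>q. slice_den q s) has_derivative
     (\<lambda>v. of_real (2 * (snd q \<bullet> snd v)) - 2 * (s - of_real (fst q)) * of_real (fst v))) (at q)"
  unfolding slice_den_def
  by (auto intro!: derivative_eq_intros simp: fun_eq_iff inner_commute algebra_simps)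

text \<open>Product and chain rule. The truncated \<open>j - 1\<close> is harmless at
  \<open>j = 0\<close>, where its coefficient vanishes.\<close>

lemma slice_ker_has_derivative:
  assumes "slice_den q s \<noteq> 0"
  shows "((\<lambda>q. slice_ker j k q s) has_derivative
     (\<lambda>v. of_real (fst v) * (2 * of_nat k * slice_ker (Suc j) (Suc k) q s - of_nat j * slice_ker (j - 1) k q s)
          - of_real (2 * real k * (snd q \<bullet> snd v)) * slice_ker j (Suc k) q s)) (at q)"
proof -
  define i where "i = inverse (slice_den q s)"
  \<comment> \<open>The factor \<open>of_nat k\<close> absorbs the truncated subtraction when
    \<open>k = 0\<close>.\<close>
  have k: "of_nat k * i * i ^ (k - 1) = of_nat k * i ^ k"
    by (cases k) auto
  have 1: "((\<lambda>q. s - of_real (fst q)) has_derivative (\<lambda>v. - of_real (fst v))) (at q)"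
    by (auto intro!: derivative_eq_intros)
  have 2: "((\<lambda>q. inverse (slice_den q s)) has_derivative
      (\<lambda>v. - (i * (of_real (2 * (snd q \<bullet> snd v)) - 2 * (s - of_real (fst q)) * of_real (fst v)) * i))) (at q)"
    unfolding i_def by (rule Deriv.has_derivative_inverse[OF assms slice_den_has_derivative])
  show ?thesis
    unfolding slice_ker_def
  proof (rule has_derivative_eq_rhs[OF has_derivative_mult[OF has_derivative_power[OF 1] has_derivative_power[OF 2]]], intro ext)
    fix v :: quat
    define x where "x = s - complex_of_real (fst q)"
    define a where "a = complex_of_real (fst v)"
    define b where "b = complex_of_real (2 * (snd q \<bullet> snd v))"
    have b: "complex_of_real (2 * real k * (snd q \<bullet> snd v)) = of_nat k * b"
      by (simp add: b_def)
    show "(s - complex_of_real (fst q)) ^ j * (of_nat k * - (i * (complex_of_real (2 * (snd q \<bullet> snd v)) - 2 * (s - complex_of_real (fst q)) * complex_of_real (fst v)) * i) * inverse (slice_den q s) ^ (k - 1))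
      + of_nat j * - complex_of_real (fst v) * (s - complex_of_real (fst q)) ^ (j - 1) * inverse (slice_den q s) ^ k
      = complex_of_real (fst v) * (2 * of_nat k * ((s - complex_of_real (fst q)) ^ Suc j * inverse (slice_den q s) ^ Suc k) - of_nat j * ((s - complex_of_real (fst q)) ^ (j - 1) * inverse (slice_den q s) ^ k))
          - complex_of_real (2 * real k * (snd q \<bullet> snd v)) * ((s - complex_of_real (fst q)) ^ j * inverse (slice_den q s) ^ Suc k)"
      unfolding i_def[symmetric] x_def[symmetric] a_def[symmetric] b b_def[symmetric]
    proof -
      have "x ^ j * (of_nat k * - (i * (b - 2 * x * a) * i) * i ^ (k - 1)) + of_nat j * - a * x ^ (j - 1) * i ^ k
          = x ^ j * (- i * (b - 2 * x * a)) * (of_nat k * i * i ^ (k - 1)) - of_nat j * a * x ^ (j - 1) * i ^ k"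
        by (simp add: algebra_simps)
      also have "\<dots> = a * (2 * of_nat k * (x ^ Suc j * i ^ Suc k) - of_nat j * (x ^ (j - 1) * i ^ k))
          - of_nat k * b * (x ^ j * i ^ Suc k)"
        unfolding k by (simp add: algebra_simps)
      finally show "x ^ j * (of_nat k * - (i * (b - 2 * x * a) * i) * i ^ (k - 1)) + of_nat j * - a * x ^ (j - 1) * i ^ k
          = a * (2 * of_nat k * (x ^ Suc j * i ^ Suc k) - of_nat j * (x ^ (j - 1) * i ^ k))
          - of_nat k * b * (x ^ j * i ^ Suc k)" .
    qed
  qed
qed

lemma continuous_on_slice_ker:
  fixes \<gamma> :: "real \<Rightarrow> complex"
  assumes "continuous_on {0..1} \<gamma>" "\<And>q t. q \<in> U \<Longrightarrow> t \<in> {0..1} \<Longrightarrow> slice_den q (\<gamma> t) \<noteq> 0"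
  shows "continuous_on (U \<times> {0..1}) (\<lambda>(q, t). slice_ker j k q (\<gamma> t))"
proof -
  have "continuous_on (U \<times> {0..1}) (\<lambda>x. \<gamma> (snd x))"
    by (rule continuous_on_compose2[OF assms(1)]) (auto intro: continuous_intros)
  then show ?thesis
    using assms(2) unfolding slice_ker_def slice_den_def case_prod_beta
    by (auto intro!: continuous_intros)
qed

lemma slice_ker_integrable:
  fixes \<gamma> \<omega> :: "real \<Rightarrow> complex"
  assumes "continuous_on {0..1} \<gamma>" "continuous_on {0..1} \<omega>" "\<And>t. t \<in> {0..1} \<Longrightarrow> slice_den q (\<gamma> t) \<noteq> 0"
  shows "(\<lambda>t. slice_ker j k q (\<gamma> t) * \<omega> t) integrable_on {0..1}"
  by (rule integrable_continuous_real)
     (use assms in \<open>auto simp: slice_ker_def slice_den_def intro!: continuous_intros\<close>)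

text \<open>\<open>leibniz_rule\<close> wants a jointly continuous derivative with values in bounded
  linear maps on a convex set. Hence the pointwise derivative \<open>D\<close> is wrapped by
  \<open>Blinfun\<close>, and the resulting operator integral is evaluated at each \<open>v\<close>
  afterwards.\<close>

lemma moment_has_derivative:
  assumes U: "open U" "convex U" "q \<in> U"
    and \<gamma>: "continuous_on {0..1} \<gamma>" and \<omega>: "continuous_on {0..1} \<omega>"
    and nz: "\<And>q t. q \<in> U \<Longrightarrow> t \<in> {0..1} \<Longrightarrow> slice_den q (\<gamma> t) \<noteq> 0"
  shows "(moment \<gamma> \<omega> j k has_derivative
     (\<lambda>v. of_real (fst v) * (2 * of_nat k * moment \<gamma> \<omega> (Suc j) (Suc k) q - of_nat j * moment \<gamma> \<omega> (j - 1) k q)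
          - of_real (2 * real k * (snd q \<bullet> snd v)) * moment \<gamma> \<omega> j (Suc k) q)) (at q)"
proof -
  define D where "D q t v =
     (of_real (fst v) * (2 * of_nat k * slice_ker (Suc j) (Suc k) q (\<gamma> t) - of_nat j * slice_ker (j - 1) k q (\<gamma> t))
          - of_real (2 * real k * (snd q \<bullet> snd v)) * slice_ker j (Suc k) q (\<gamma> t)) * \<omega> t" for q t v
  have D: "((\<lambda>q. slice_ker j k q (\<gamma> t) * \<omega> t) has_derivative D q t) (at q)"
    if "q \<in> U" "t \<in> {0..1}" for q t
    unfolding D_def by (rule has_derivative_mult_left[OF slice_ker_has_derivative[OF nz[OF that]]])
  have BD: "blinfun_apply (Blinfun (D q t)) = D q t" if "q \<in> U" "t \<in> {0..1}" for q t
    by (rule bounded_linear_Blinfun_apply) (use D[OF that] has_derivative_bounded_linear in blast)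
  have cont: "continuous_on (U \<times> cbox 0 1) (\<lambda>(q, t). Blinfun (D q t))"
  \<comment> \<open>The domain is finite dimensional, so continuity in operator norm may be tested
    on basis vectors.\<close>
  proof (rule continuous_on_blinfun_componentwise)
    fix i :: quat
    have 1: "continuous_on (U \<times> {0..1}) (\<lambda>x. slice_ker j k (fst x) (\<gamma> (snd x)))" for j k
      using continuous_on_slice_ker[OF \<gamma> nz, of U j k] by (simp add: case_prod_beta)
    have 2: "continuous_on (U \<times> {0..1}) (\<lambda>x. \<omega> (snd x))"
      by (rule continuous_on_compose2[OF \<omega>]) (auto intro: continuous_intros)
    have "continuous_on (U \<times> {0..1}) (\<lambda>x. D (fst x) (snd x) i)"
      unfolding D_def by (intro continuous_intros 1 2)
    then have "continuous_on (U \<times> {0..1}) (\<lambda>x. blinfun_apply (case x of (q, t) \<Rightarrow> Blinfun (D q t)) i)"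
      by (rule continuous_on_eq) (auto simp: BD)
    then show "continuous_on (U \<times> cbox 0 1) (\<lambda>x. blinfun_apply (case x of (q, t) \<Rightarrow> Blinfun (D q t)) i)"
      by simp
  qed
  have "((\<lambda>q. integral (cbox 0 1) (\<lambda>t. slice_ker j k q (\<gamma> t) * \<omega> t)) has_derivative
      blinfun_apply (integral (cbox 0 1) (\<lambda>t. Blinfun (D q t)))) (at q within U)"
  proof (rule leibniz_rule[OF _ _ cont])
    fix q t assume "q \<in> U" "t \<in> cbox (0::real) 1"
    then show "((\<lambda>q. slice_ker j k q (\<gamma> t) * \<omega> t) has_derivative blinfun_apply (Blinfun (D q t))) (at q within U)"
      using D[of q t] BD[of q t] by (auto intro: has_derivative_at_withinI)
  next
    fix q assume "q \<in> U"
    then show "(\<lambda>t. slice_ker j k q (\<gamma> t) * \<omega> t) integrable_on cbox 0 1"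
      using slice_ker_integrable[OF \<gamma> \<omega> nz] by simp
  qed (use U in auto)
  then have "(moment \<gamma> \<omega> j k has_derivative blinfun_apply (integral {0..1} (\<lambda>t. Blinfun (D q t)))) (at q)"
    unfolding moment_def[abs_def] using at_within_open[OF U(3,1)] by simp
  then show ?thesis
  proof (rule has_derivative_eq_rhs, intro ext)
    fix v
    have int: "(\<lambda>t. slice_ker j k q (\<gamma> t) * \<omega> t) integrable_on {0..1}" for j k
      by (rule slice_ker_integrable[OF \<gamma> \<omega> nz[OF U(3)]])
    have "(\<lambda>t. Blinfun (D q t)) integrable_on {0..1}"
      using continuous_on_compose2[OF cont continuous_on_Pair[OF continuous_on_const[of _ q] continuous_on_id], of "{0..1}"] U
      by (intro integrable_continuous_real) auto
    then have "blinfun_apply (integral {0..1} (\<lambda>t. Blinfun (D q t))) v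
        = integral {0..1} (\<lambda>t. blinfun_apply (Blinfun (D q t)) v)"
      by (rule blinfun_apply_integral)
    also have "\<dots> = integral {0..1} (\<lambda>t. D q t v)"
      using BD[OF U(3)] by (intro integral_cong) auto
    also have "\<dots> = integral {0..1} (\<lambda>t. (of_real (fst v) * (2 * of_nat k)) * (slice_ker (Suc j) (Suc k) q (\<gamma> t) * \<omega> t)
          - (of_real (fst v) * of_nat j) * (slice_ker (j - 1) k q (\<gamma> t) * \<omega> t)
          - of_real (2 * real k * (snd q \<bullet> snd v)) * (slice_ker j (Suc k) q (\<gamma> t) * \<omega> t))"
      by (intro integral_cong) (simp add: D_def algebra_simps)
    also have "\<dots> = (of_real (fst v) * (2 * of_nat k)) * moment \<gamma> \<omega> (Suc j) (Suc k) q
          - (of_real (fst v) * of_nat j) * moment \<gamma> \<omega> (j - 1) k q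
          - of_real (2 * real k * (snd q \<bullet> snd v)) * moment \<gamma> \<omega> j (Suc k) q"
      unfolding moment_def integral_mult_right[symmetric]
      by (subst integral_diff integral_mult_right, (intro integrable_diff integrable_on_mult_right int)+)+ simp
    finally show "blinfun_apply (integral {0..1} (\<lambda>t. Blinfun (D q t))) v = 
       of_real (fst v) * (2 * of_nat k * moment \<gamma> \<omega> (Suc j) (Suc k) q - of_nat j * moment \<gamma> \<omega> (j - 1) k q)
          - of_real (2 * real k * (snd q \<bullet> snd v)) * moment \<gamma> \<omega> j (Suc k) q"
      by (simp add: algebra_simps)
  qed
qed

lemma moment_reduce:
  assumes \<gamma>: "continuous_on {0..1} \<gamma>" and \<omega>: "continuous_on {0..1} \<omega>"
    and nz: "\<And>t. t \<in> {0..1} \<Longrightarrow> slice_den q (\<gamma> t) \<noteq> 0"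
  shows "moment \<gamma> \<omega> (Suc (Suc j)) (Suc k) q + of_real (snd q \<bullet> snd q) * moment \<gamma> \<omega> j (Suc k) q
       = moment \<gamma> \<omega> j k q"
proof -
  note int = slice_ker_integrable[OF \<gamma> \<omega> nz]
  have ker: "slice_ker (Suc (Suc j)) (Suc k) q s + of_real (snd q \<bullet> snd q) * slice_ker j (Suc k) q s
      = slice_ker j k q s" if "slice_den q s \<noteq> 0" for s
  proof -
    have "slice_ker (Suc (Suc j)) (Suc k) q s + of_real (snd q \<bullet> snd q) * slice_ker j (Suc k) q s
       = slice_den q s * inverse (slice_den q s) * slice_ker j k q s"
      by (simp add: slice_ker_def slice_den_def power2_eq_square algebra_simps)
    then show ?thesis
      using that by simp
  qed
  have "moment \<gamma> \<omega> (Suc (Suc j)) (Suc k) q + of_real (snd q \<bullet> snd q) * moment \<gamma> \<omega> j (Suc k) q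
      = integral {0..1} (\<lambda>t. slice_ker (Suc (Suc j)) (Suc k) q (\<gamma> t) * \<omega> t
          + of_real (snd q \<bullet> snd q) * (slice_ker j (Suc k) q (\<gamma> t) * \<omega> t))"
    unfolding moment_def by (subst integral_add) (auto intro!: int integrable_on_mult_right)
  also have "\<dots> = moment \<gamma> \<omega> j k q"
    unfolding moment_def
    by (intro integral_cong) (simp add: ker[OF nz, symmetric] distrib_right)
  finally show ?thesis .
qed

section \<open>Harmonicity and the Fueter operator\<close>

definition qim :: "quat \<Rightarrow> quat" where "qim q = (0, snd q)"

lemma bounded_bilinear_qmult: "bounded_bilinear (\<odot>)"
  unfolding bilinear_conv_bounded_bilinear[symmetric] bilinear_def
  by (auto simp: linear_iff qmult_def algebra_simps split: prod.splits)

lemma bounded_linear_qim: "bounded_linear qim"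
  unfolding qim_def by (intro bounded_linear_Pair bounded_linear_zero bounded_linear_snd)

section \<open>Locality of partial derivatives and of harmonicity\<close>

lemma pd_eq:
  assumes "(g has_derivative g') (at q)"
  shows "pd i g q = g' (qe i)"
  using frechet_derivative_at[OF assms] by (simp add: pd_def)

lemma differentiable_cong_open:
  assumes "open V" "q \<in> V" "\<And>x. x \<in> V \<Longrightarrow> g x = h x"
  shows "g differentiable (at q) \<longleftrightarrow> h differentiable (at q)"
  using has_derivative_transform_within_open[OF _ assms(1,2), of g _ UNIV h]
    has_derivative_transform_within_open[OF _ assms(1,2), of h _ UNIV g] assms(3)
  unfolding differentiable_def by metis

lemma pd_cong_open:
  assumes "open V" "q \<in> V" "\<And>x. x \<in> V \<Longrightarrow> g x = h x"
  shows "pd i g q = pd i h q"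
proof -
  have "(g has_derivative D) (at q) \<longleftrightarrow> (h has_derivative D) (at q)" for D
    using has_derivative_transform_within_open[OF _ assms(1,2), of g _ UNIV h]
      has_derivative_transform_within_open[OF _ assms(1,2), of h _ UNIV g] assms(3) by metis
  then show ?thesis
    by (simp add: pd_def frechet_derivative_def)
qed

lemma fueter_left_cong_open:
  assumes "open V" "q \<in> V" "\<And>x. x \<in> V \<Longrightarrow> g x = h x"
  shows "fueter_left g q = fueter_left h q"
  unfolding fueter_left_def using pd_cong_open[OF assms] by simp

lemma fueter_right_cong_open:
  assumes "open V" "q \<in> V" "\<And>x. x \<in> V \<Longrightarrow> g x = h x"
  shows "fueter_right g q = fueter_right h q"
  unfolding fueter_right_def using pd_cong_open[OF assms] by simp

text \<open>Integral representations exist only near each point. Every clause of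
  \<open>harmonic_on\<close>, including continuity of the second derivatives, can be checked on a
  neighbourhood.\<close>

lemma harmonic_on_local:
  assumes "\<And>q. q \<in> S \<Longrightarrow> \<exists>V h. open V \<and> q \<in> V \<and> (\<forall>x\<in>V. g x = h x) \<and> harmonic_on V h"
  shows "harmonic_on S g"
proof -
  have *: "g differentiable (at q) \<and> (\<forall>i<4. pd i g differentiable (at q)) \<and>
      (\<forall>i<4. \<forall>j<4. isCont (pd i (pd j g)) q) \<and> (\<Sum>i<4. pd i (pd i g) q) = 0" if q: "q \<in> S" for q
  proof -
    obtain V h where V: "open V" "q \<in> V" "\<And>x. x \<in> V \<Longrightarrow> g x = h x" and h: "harmonic_on V h"
      using assms[OF q] by blast
    have 1: "pd i g x = pd i h x" if "x \<in> V" for i x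
      using pd_cong_open[OF V(1) that V(3)] .
    have 2: "pd i (pd j g) x = pd i (pd j h) x" if "x \<in> V" for i j x
      using pd_cong_open[OF V(1) that 1] .
    have "isCont (pd i (pd j g)) q" if "i < 4" "j < 4" for i j
    proof -
      have "continuous_on V (pd i (pd j h))"
        using h that by (auto simp: harmonic_on_def)
      then have "continuous_on V (pd i (pd j g))"
        by (rule continuous_on_eq) (simp add: 2)
      then show ?thesis
        using V by (simp add: continuous_on_eq_continuous_at)
    qed
    then show ?thesis
      using h V(2) differentiable_cong_open[OF V] differentiable_cong_open[OF V(1,2) 1]
      by (simp add: harmonic_on_def 2)
  qed
  show ?thesis
    unfolding harmonic_on_def using * by (auto intro: continuous_at_imp_continuous_on)
qed

text \<open>\<open>M j k\<close> abstracts the integrals of \<open>(s - x) ^ j F s / (s\<^sup>2 - 2 x s + |q|\<^sup>2) ^ k\<close>; the first law is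
  differentiation under the integral sign, the second one is
  \<open>s\<^sup>2 - 2 x s + |q|\<^sup>2 = (s - x)\<^sup>2 + r\<^sup>2\<close>.\<close>
locale moment_system =
  fixes V :: "quat set" and M :: "nat \<Rightarrow> nat \<Rightarrow> quat \<Rightarrow> quat"
  assumes open_V: "open V"
    and M_deriv: "q \<in> V \<Longrightarrow> (M j k has_derivative
      (\<lambda>v. fst v *\<^sub>R ((2 * real k) *\<^sub>R M (Suc j) (Suc k) q - real j *\<^sub>R M (j - 1) k q)
           - (2 * real k * (snd q \<bullet> snd v)) *\<^sub>R M j (Suc k) q)) (at q)"
    and M_reduce: "q \<in> V \<Longrightarrow> M (Suc (Suc j)) (Suc k) q + (snd q \<bullet> snd q) *\<^sub>R M j (Suc k) q = M j k q"
begin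

lemma continuous_on_M: "continuous_on V (M j k)"
  using has_derivative_continuous_on[OF has_derivative_at_withinI[OF M_deriv]] .

lemma harmonic_on_M: "harmonic_on V (\<lambda>q. c *\<^sub>R M 0 (Suc 0) q)"
proof -
  \<comment> \<open>\<open>G\<close> and \<open>H\<close> are the first and second partial
    derivatives predicted by \<open>M_deriv\<close>, written as combinations of moments so that they
    can be differentiated again and summed.\<close>
  define G where "G i q = c *\<^sub>R ((2 * fst (qe i)) *\<^sub>R M 1 2 q - (2 * (snd q \<bullet> snd (qe i))) *\<^sub>R M 0 2 q)" for i q
  define H where "H j i q = c *\<^sub>R ((2 * fst (qe i)) *\<^sub>R
       (fst (qe j) *\<^sub>R (4 *\<^sub>R M 2 3 q - M 0 2 q) - (4 * (snd q \<bullet> snd (qe j))) *\<^sub>R M 1 3 q)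
     - ((2 * (snd q \<bullet> snd (qe i))) *\<^sub>R
       (fst (qe j) *\<^sub>R (4 *\<^sub>R M 1 3 q) - (4 * (snd q \<bullet> snd (qe j))) *\<^sub>R M 0 3 q)
     + (2 * (snd (qe j) \<bullet> snd (qe i))) *\<^sub>R M 0 2 q))" for i j q
  have d1: "((\<lambda>q. c *\<^sub>R M 0 (Suc 0) q) has_derivative (\<lambda>v. c *\<^sub>R (fst v *\<^sub>R (2 *\<^sub>R M 1 2 q)
      - (2 * (snd q \<bullet> snd v)) *\<^sub>R M 0 2 q))) (at q)" if "q \<in> V" for q
    by (rule has_derivative_scaleR_right[OF has_derivative_eq_rhs[OF M_deriv[OF that]]])
       (simp add: eval_nat_numeral)
  have pd1: "pd i (\<lambda>q. c *\<^sub>R M 0 (Suc 0) q) q = G i q" if "q \<in> V" for i q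
    using pd_eq[OF d1[OF that]] by (simp add: G_def mult.commute)
  have M12: "(M 1 2 has_derivative (\<lambda>v. fst v *\<^sub>R (4 *\<^sub>R M 2 3 q - M 0 2 q) - (4 * (snd q \<bullet> snd v)) *\<^sub>R M 1 3 q)) (at q)"
    if "q \<in> V" for q
    by (rule has_derivative_eq_rhs[OF M_deriv[OF that]]) (simp add: eval_nat_numeral)
  have M02: "(M 0 2 has_derivative (\<lambda>v. fst v *\<^sub>R (4 *\<^sub>R M 1 3 q) - (4 * (snd q \<bullet> snd v)) *\<^sub>R M 0 3 q)) (at q)"
    if "q \<in> V" for q
    by (rule has_derivative_eq_rhs[OF M_deriv[OF that]]) (simp add: eval_nat_numeral)
  have d2: "(G i has_derivative (\<lambda>v. c *\<^sub>R ((2 * fst (qe i)) *\<^sub>R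
       (fst v *\<^sub>R (4 *\<^sub>R M 2 3 q - M 0 2 q) - (4 * (snd q \<bullet> snd v)) *\<^sub>R M 1 3 q)
     - ((2 * (snd q \<bullet> snd (qe i))) *\<^sub>R
       (fst v *\<^sub>R (4 *\<^sub>R M 1 3 q) - (4 * (snd q \<bullet> snd v)) *\<^sub>R M 0 3 q)
     + (2 * (snd v \<bullet> snd (qe i))) *\<^sub>R M 0 2 q)))) (at q)" if "q \<in> V" for i q
    unfolding G_def
    by (intro has_derivative_scaleR_right has_derivative_diff M12 that has_derivative_scaleR M02
        has_derivative_mult_right has_derivative_inner_left has_derivative_snd has_derivative_ident)
  have d1': "(\<lambda>q. c *\<^sub>R M 0 (Suc 0) q) differentiable (at q)" if "q \<in> V" for q
    using d1[OF that] unfolding differentiable_def by blast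
  have d2': "pd i (\<lambda>q. c *\<^sub>R M 0 (Suc 0) q) differentiable (at q)" if "q \<in> V" for i q
    using d2[OF that] differentiable_cong_open[OF open_V that pd1] by (auto simp: differentiable_def)
  have pd2: "pd j (pd i (\<lambda>q. c *\<^sub>R M 0 (Suc 0) q)) q = H j i q" if "q \<in> V" for i j q
  proof -
    have "pd j (pd i (\<lambda>q. c *\<^sub>R M 0 (Suc 0) q)) q = pd j (G i) q"
      by (rule pd_cong_open[OF open_V that]) (rule pd1)
    also have "\<dots> = H j i q"
      unfolding H_def by (rule pd_eq[OF d2[OF that]])
    finally show ?thesis .
  qed
  have "continuous_on V (H i j)" for i j
    unfolding H_def by (intro continuous_intros continuous_on_M)
  then have "continuous_on V (pd i (pd j (\<lambda>q. c *\<^sub>R M 0 (Suc 0) q)))" for i j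
    by (rule continuous_on_eq) (simp add: pd2)
  moreover have "(\<Sum>i<4. H i i q) = 0" if "q \<in> V" for q
  proof -
    have r: "M 0 2 q = M 2 3 q + (snd q \<bullet> snd q) *\<^sub>R M 0 3 q"
      using M_reduce[OF that, of 0 2] by (simp add: eval_nat_numeral)
    obtain q0 q1 q2 q3 where q: "q = (q0, q1, q2, q3)"
      by (cases q) auto
    have s: "{..<4::nat} = {0,1,2,3}"
      by auto
    \<comment> \<open>Each of the four directions contributes -2 \<open>M 0 2\<close>. The total of
      -8 is balanced, through \<open>r\<close>, by the 8 in front of the two moments with
      \<open>k = 3\<close>: dimension four is exactly right.\<close>
    have "(\<Sum>i<4. H i i q) = c *\<^sub>R (8 *\<^sub>R M 2 3 q - 8 *\<^sub>R M 0 2 q + (8 * (snd q \<bullet> snd q)) *\<^sub>R M 0 3 q)"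
      unfolding s by (cases "M 2 3 q"; cases "M 0 2 q"; cases "M 1 3 q"; cases "M 0 3 q")
        (simp add: H_def qe_def q algebra_simps)
    then show ?thesis
      by (simp add: r algebra_simps)
  qed
  ultimately show ?thesis
    unfolding harmonic_on_def using d1' d2' by (simp add: pd2)
qed

text \<open>The differentiated map is \<alpha> + J \<beta> in the form \<alpha> + (r J) (\<beta> /
  r). Taking \<open>B\<close> as the quaternion product or as its flip covers left and right
  functions with one computation.\<close>

lemma qim_M_deriv:
  assumes "bounded_bilinear B" "q \<in> V"
  shows "((\<lambda>q. M (Suc 0) (Suc 0) q + B (qim q) (M 0 (Suc 0) q)) has_derivative
     (\<lambda>v. fst v *\<^sub>R (2 *\<^sub>R M 2 2 q - M 0 (Suc 0) q) - (2 * (snd q \<bullet> snd v)) *\<^sub>R M 1 2 q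
       + (B (qim q) (fst v *\<^sub>R (2 *\<^sub>R M 1 2 q) - (2 * (snd q \<bullet> snd v)) *\<^sub>R M 0 2 q)
       + B (qim v) (M 0 (Suc 0) q)))) (at q)"
proof (intro has_derivative_add bounded_bilinear.FDERIV[OF assms(1)])
  show "(qim has_derivative qim) (at q)"
    by (rule bounded_linear_imp_has_derivative[OF bounded_linear_qim])
qed (rule has_derivative_eq_rhs[OF M_deriv[OF assms(2)]], simp add: eval_nat_numeral)+

text \<open>The \<open>M 1 2\<close> terms cancel. Since \<open>qim q\<close> squares to -r^2, the
  second-order moments combine to 2 (\<open>M 2 2\<close> + r^2 \<open>M 0 2\<close>), which is 2
  \<open>M 0 1\<close> by \<open>r\<close>. The real direction adds - \<open>M 0 1\<close> and the
  squares of the three imaginary units add -3 \<open>M 0 1\<close>, leaving -2.\<close>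

lemma fueter_left_M:
  assumes "q \<in> V"
  shows "fueter_left (\<lambda>q. M (Suc 0) (Suc 0) q + qim q \<odot> M 0 (Suc 0) q) q = (-2) *\<^sub>R M 0 (Suc 0) q"
proof -
  have r: "M 0 (Suc 0) q = M 2 2 q + (snd q \<bullet> snd q) *\<^sub>R M 0 2 q"
    using M_reduce[OF assms, of 0 1] by (simp add: eval_nat_numeral)
  obtain q0 q1 q2 q3 where q: "q = (q0, q1, q2, q3)"
    by (cases q) auto
  obtain a0 a1 a2 a3 where a: "M 2 2 q = (a0, a1, a2, a3)"
    by (cases "M 2 2 q") auto
  obtain b0 b1 b2 b3 where b: "M 1 2 q = (b0, b1, b2, b3)"
    by (cases "M 1 2 q") auto
  obtain c0 c1 c2 c3 where c: "M 0 2 q = (c0, c1, c2, c3)"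
    by (cases "M 0 2 q") auto
  show ?thesis
    unfolding fueter_left_def pd_eq[OF qim_M_deriv[OF bounded_bilinear_qmult assms]] r a b c
    by (simp add: q qmult_def qe_def qim_def algebra_simps)
qed

lemma fueter_right_M:
  assumes "q \<in> V"
  shows "fueter_right (\<lambda>q. M (Suc 0) (Suc 0) q + M 0 (Suc 0) q \<odot> qim q) q = (-2) *\<^sub>R M 0 (Suc 0) q"
proof -
  have r: "M 0 (Suc 0) q = M 2 2 q + (snd q \<bullet> snd q) *\<^sub>R M 0 2 q"
    using M_reduce[OF assms, of 0 1] by (simp add: eval_nat_numeral)
  obtain q0 q1 q2 q3 where q: "q = (q0, q1, q2, q3)"
    by (cases q) auto
  obtain a0 a1 a2 a3 where a: "M 2 2 q = (a0, a1, a2, a3)"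
    by (cases "M 2 2 q") auto
  obtain b0 b1 b2 b3 where b: "M 1 2 q = (b0, b1, b2, b3)"
    by (cases "M 1 2 q") auto
  obtain c0 c1 c2 c3 where c: "M 0 2 q = (c0, c1, c2, c3)"
    by (cases "M 0 2 q") auto
  show ?thesis
    unfolding fueter_right_def pd_eq[OF qim_M_deriv[OF bounded_bilinear.flip[OF bounded_bilinear_qmult] assms]] r a b c
    by (simp add: q qmult_def qe_def qim_def algebra_simps)
qed

end

section \<open>Cauchy's formula for the slice kernel\<close>

definition slice_coord :: "quat \<Rightarrow> complex" where
  "slice_coord q = Complex (fst q) (norm (snd q))"

text \<open>On the real axis the quotient \<open>Im (F z) / Im z\<close> is replaced by its limit.\<close>
definition slice_quot :: "(complex \<Rightarrow> complex) \<Rightarrow> quat \<Rightarrow> real" where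
  "slice_quot F q = (if snd q = 0 then Re (deriv F (slice_coord q))
                     else Im (F (slice_coord q)) / norm (snd q))"

lemma slice_coord_simps [simp]: "Re (slice_coord q) = fst q" "Im (slice_coord q) = norm (snd q)"
  by (simp_all add: slice_coord_def)

lemma continuous_on_slice_coord: "continuous_on A slice_coord"
  unfolding slice_coord_def Complex_eq by (intro continuous_intros)

lemma slice_den_factor: "slice_den q s = (s - slice_coord q) * (s - cnj (slice_coord q))"
  by (simp add: slice_den_def complex_eq_iff power2_eq_square dot_square_norm algebra_simps)

text \<open>Serves partial fraction decompositions: the identity for \<open>h\<close> is required
  only on \<open>S\<close>, from which the poles will have been removed.\<close>

lemma contour_integral_sum_lin:
  assumes "open S" "f holomorphic_on S" "g holomorphic_on S"
    and "\<And>\<gamma>. \<gamma> \<in> set \<Gamma> \<Longrightarrow> valid_path \<gamma> \<and> path_image \<gamma> \<subseteq> S"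
    and "\<And>s. s \<in> S \<Longrightarrow> h s = a * f s + b * g s"
  shows "(\<Sum>\<gamma>\<leftarrow>\<Gamma>. contour_integral \<gamma> h)
     = a * (\<Sum>\<gamma>\<leftarrow>\<Gamma>. contour_integral \<gamma> f) + b * (\<Sum>\<gamma>\<leftarrow>\<Gamma>. contour_integral \<gamma> g)"
proof -
  have "contour_integral \<gamma> h = a * contour_integral \<gamma> f + b * contour_integral \<gamma> g" if "\<gamma> \<in> set \<Gamma>" for \<gamma>
  proof -
    note g = assms(4)[OF that]
    have int: "f contour_integrable_on \<gamma>" "g contour_integrable_on \<gamma>"
      using g assms contour_integrable_holomorphic_simple by blast+
    have "contour_integral \<gamma> h = contour_integral \<gamma> (\<lambda>s. a * f s + b * g s)"
      using g assms(5) by (intro contour_integral_eq) auto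
    then show ?thesis
      using int by (simp add: contour_integral_add contour_integral_lmul contour_integrable_lmul)
  qed
  then have "(\<Sum>\<gamma>\<leftarrow>\<Gamma>. contour_integral \<gamma> h)
      = (\<Sum>\<gamma>\<leftarrow>\<Gamma>. a * contour_integral \<gamma> f + b * contour_integral \<gamma> g)"
    by (intro arg_cong[of _ _ sum_list] map_cong) auto
  then show ?thesis
    by (simp add: sum_list_addf sum_list_const_mult)
qed

text \<open>Near a real point \<open>F\<close> coincides with its conjugate reflection, so the
  derivative there equals its own conjugate. This justifies the \<open>Re\<close> in
  \<open>slice_quot\<close>.\<close>

lemma deriv_cnj_real:
  assumes "open S" "F holomorphic_on S" "z \<in> S" "Im z = 0" "\<And>s. s \<in> S \<Longrightarrow> F (cnj s) = cnj (F s)"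
  shows "of_real (Re (deriv F z)) = deriv F z"
proof -
  have z: "cnj z = z"
    using assms(4) by (simp add: complex_eq_iff)
  have d: "(F has_field_derivative deriv F z) (at z)"
    using assms holomorphic_derivI by blast
  then have "((cnj \<circ> F \<circ> cnj) has_field_derivative cnj (deriv F z)) (at z)"
    by (intro has_field_derivative_cnj_cnj) (simp add: z)
  then have "(F has_field_derivative cnj (deriv F z)) (at z)"
    by (rule has_field_derivative_transform_within_open[OF _ assms(1,3)])
       (simp add: assms(5))
  then have "cnj (deriv F z) = deriv F z"
    using d DERIV_unique by blast
  then show ?thesis
    by (simp add: complex_eq_iff)
qed

text \<open>Collects what the boundary of a slice of \<open>U\<close> and a family of small circles
  have in common, so that one evaluation yields both the boundary integral and the local
  representation of the stem.\<close>

locale slice_cycle =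
  fixes S :: "complex set" and \<Gamma> :: "(real \<Rightarrow> complex) list" and q :: quat
  assumes open_S: "open S"
    and q_S: "slice_coord q \<in> S" "cnj (slice_coord q) \<in> S"
    and cycle: "\<gamma> \<in> set \<Gamma> \<Longrightarrow> valid_path \<gamma> \<and> pathfinish \<gamma> = pathstart \<gamma> \<and>
        path_image \<gamma> \<subseteq> S - {slice_coord q, cnj (slice_coord q)}"
    and winding_out: "z \<notin> S \<Longrightarrow> (\<Sum>\<gamma>\<leftarrow>\<Gamma>. winding_number \<gamma> z) = 0"
    and winding_in: "(\<Sum>\<gamma>\<leftarrow>\<Gamma>. winding_number \<gamma> (slice_coord q)) = 1"
      "(\<Sum>\<gamma>\<leftarrow>\<Gamma>. winding_number \<gamma> (cnj (slice_coord q))) = 1"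
begin

lemma Cauchy_in:
  assumes "F holomorphic_on S"
  shows "(\<Sum>\<gamma>\<leftarrow>\<Gamma>. contour_integral \<gamma> (\<lambda>s. F s / (s - slice_coord q))) = 2 * pi * \<i> * F (slice_coord q)"
    and "(\<Sum>\<gamma>\<leftarrow>\<Gamma>. contour_integral \<gamma> (\<lambda>s. F s / (s - cnj (slice_coord q)))) = 2 * pi * \<i> * F (cnj (slice_coord q))"
  using Cauchy_integral_formula_cycle[OF open_S assms q_S(1), of \<Gamma>]
    Cauchy_integral_formula_cycle[OF open_S assms q_S(2), of \<Gamma>] cycle winding_out winding_in by fastforce+

context
  fixes F
  assumes F: "F holomorphic_on S" and sym: "\<And>s. s \<in> S \<Longrightarrow> F (cnj s) = cnj (F s)"
begin

text \<open>The numerator s - x is the mean of s - z and s - \<open>cnj\<close> z, so the kernel is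
  the mean of the two Cauchy kernels, and the integral averages \<open>F\<close> over conjugate
  points. This remains valid when they coincide.\<close>

lemma integral_slice_ker_1_1:
  "(\<Sum>\<gamma>\<leftarrow>\<Gamma>. contour_integral \<gamma> (\<lambda>s. slice_ker (Suc 0) (Suc 0) q s * F s)) = 2 * pi * \<i> * of_real (Re (F (slice_coord q)))"
proof -
  let ?z = "slice_coord q"
  have "(\<Sum>\<gamma>\<leftarrow>\<Gamma>. contour_integral \<gamma> (\<lambda>s. slice_ker (Suc 0) (Suc 0) q s * F s))
      = (1/2) * (\<Sum>\<gamma>\<leftarrow>\<Gamma>. contour_integral \<gamma> (\<lambda>s. F s / (s - ?z)))
      + (1/2) * (\<Sum>\<gamma>\<leftarrow>\<Gamma>. contour_integral \<gamma> (\<lambda>s. F s / (s - cnj ?z)))"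
  proof (rule contour_integral_sum_lin[of "S - {?z, cnj ?z}"])
    fix s assume "s \<in> S - {?z, cnj ?z}"
    then have s: "s - ?z \<noteq> 0" "s - cnj ?z \<noteq> 0"
      by auto
    have x: "s - of_real (fst q) = ((s - ?z) + (s - cnj ?z)) / 2"
      by (simp add: complex_eq_iff)
    have "(a + b) / 2 * inverse (a * b) * c = 1 / 2 * (c / a) + 1 / 2 * (c / b)"
      if "a \<noteq> 0" "b \<noteq> 0" for a b c :: complex
      using that by (simp add: field_simps)
    from this[OF s] show "slice_ker (Suc 0) (Suc 0) q s * F s = 1 / 2 * (F s / (s - ?z)) + 1 / 2 * (F s / (s - cnj ?z))"
      by (simp only: slice_ker_def slice_den_factor x power_one_right One_nat_def[symmetric])
  qed (use open_S cycle F in \<open>auto intro!: holomorphic_intros open_Diff elim: holomorphic_on_subset\<close>)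
  also have "\<dots> = 2 * pi * \<i> * ((F ?z + cnj (F ?z)) / 2)"
    unfolding Cauchy_in[OF F] sym[OF q_S(1)] by (simp add: field_simps)
  also have "(F ?z + cnj (F ?z)) / 2 = of_real (Re (F ?z))"
    by (simp add: complex_eq_iff)
  finally show ?thesis .
qed

text \<open>For nonreal \<open>q\<close> partial fractions give the difference quotient of
  \<open>F\<close> between conjugate points, which is Im F / r by symmetry. For real
  \<open>q\<close> the poles merge into a double pole, which produces the derivative.\<close>

lemma integral_slice_ker_0_1:
  "(\<Sum>\<gamma>\<leftarrow>\<Gamma>. contour_integral \<gamma> (\<lambda>s. slice_ker 0 (Suc 0) q s * F s)) = 2 * pi * \<i> * of_real (slice_quot F q)"
proof (cases "snd q = 0")
  case False
  let ?z = "slice_coord q"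
  have "Im ?z \<noteq> 0"
    using False by simp
  then have z: "?z \<noteq> cnj ?z"
    by (metis complex_cnj_cancel_iff complex_cnj_complex_of_real Im_complex_of_real Reals_cnj_iff Reals_cases)
  have "(\<Sum>\<gamma>\<leftarrow>\<Gamma>. contour_integral \<gamma> (\<lambda>s. slice_ker 0 (Suc 0) q s * F s))
      = (1 / (?z - cnj ?z)) * (\<Sum>\<gamma>\<leftarrow>\<Gamma>. contour_integral \<gamma> (\<lambda>s. F s / (s - ?z)))
      + (- 1 / (?z - cnj ?z)) * (\<Sum>\<gamma>\<leftarrow>\<Gamma>. contour_integral \<gamma> (\<lambda>s. F s / (s - cnj ?z)))"
  proof (rule contour_integral_sum_lin[of "S - {?z, cnj ?z}"])
    fix s assume "s \<in> S - {?z, cnj ?z}"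
    then have s: "s - ?z \<noteq> 0" "s - cnj ?z \<noteq> 0" "?z - cnj ?z \<noteq> 0"
      using z by auto
    then show "slice_ker 0 (Suc 0) q s * F s = 1 / (?z - cnj ?z) * (F s / (s - ?z)) + - 1 / (?z - cnj ?z) * (F s / (s - cnj ?z))"
      by (simp add: slice_ker_def slice_den_factor divide_simps del: right_minus_eq) (simp add: algebra_simps)
  qed (use open_S cycle F in \<open>auto intro!: holomorphic_intros open_Diff elim: holomorphic_on_subset\<close>)
  also have "\<dots> = 2 * pi * \<i> * ((F ?z - cnj (F ?z)) / (?z - cnj ?z))"
    unfolding Cauchy_in[OF F] sym[OF q_S(1)] by (simp add: diff_divide_distrib algebra_simps)
  also have "(F ?z - cnj (F ?z)) / (?z - cnj ?z) = of_real (slice_quot F q)"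
    using False by (simp add: slice_quot_def complex_diff_cnj)
  finally show ?thesis .
next
  case True
  let ?z = "slice_coord q"
  have z: "cnj ?z = ?z"
    using True by (simp add: complex_eq_iff)
  let ?d = "\<lambda>w. if w = ?z then deriv F ?z else (F w - F ?z) / (w - ?z)"
  have d: "?d holomorphic_on S"
    by (rule pole_lemma_open[OF F open_S])
  \<comment> \<open>The double pole is reduced to a simple one: the difference quotient
    \<open>?d\<close> absorbs one factor, and the remainder is a multiple of 1 / (s - z)^2, which
    has a primitive off z.\<close>
  have "(\<Sum>\<gamma>\<leftarrow>\<Gamma>. contour_integral \<gamma> (\<lambda>s. slice_ker 0 (Suc 0) q s * F s))
      = 1 * (\<Sum>\<gamma>\<leftarrow>\<Gamma>. contour_integral \<gamma> (\<lambda>s. ?d s / (s - ?z)))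
      + F ?z * (\<Sum>\<gamma>\<leftarrow>\<Gamma>. contour_integral \<gamma> (\<lambda>s. 1 / (s - ?z)\<^sup>2))"
  proof (rule contour_integral_sum_lin[of "S - {?z}"])
    fix s assume "s \<in> S - {?z}"
    then show "slice_ker 0 (Suc 0) q s * F s = 1 * (?d s / (s - ?z)) + F ?z * (1 / (s - ?z)\<^sup>2)"
      by (simp add: slice_ker_def slice_den_factor z divide_simps power2_eq_square)
  next
    show "(\<lambda>s. ?d s / (s - ?z)) holomorphic_on S - {?z}"
      by (intro holomorphic_on_divide holomorphic_on_subset[OF d] holomorphic_intros) auto
  qed (use open_S cycle in \<open>auto intro!: holomorphic_intros\<close>)
  also have "(\<Sum>\<gamma>\<leftarrow>\<Gamma>. contour_integral \<gamma> (\<lambda>s. 1 / (s - ?z)\<^sup>2)) = 0"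
  proof -
    have "contour_integral \<gamma> (\<lambda>s. 1 / (s - ?z)\<^sup>2) = 0" if "\<gamma> \<in> set \<Gamma>" for \<gamma>
    proof -
      have "((\<lambda>s. - 1 / (s - ?z)) has_field_derivative 1 / (s - ?z)\<^sup>2) (at s within - {?z})" if "s \<in> - {?z}" for s
        using that by (auto intro!: derivative_eq_intros simp: power2_eq_square divide_simps)
      then have "((\<lambda>s. 1 / (s - ?z)\<^sup>2) has_contour_integral 0) \<gamma>"
        by (rule Cauchy_theorem_primitive[of "- {?z}"]) (use cycle[OF that] in auto)
      then show ?thesis
        by (rule contour_integral_unique)
    qed
    then show ?thesis
      by (simp add: sum_list_0 cong: map_cong)
  qed
  also have "1 * (\<Sum>\<gamma>\<leftarrow>\<Gamma>. contour_integral \<gamma> (\<lambda>s. ?d s / (s - ?z))) + F ?z * 0 = 2 * pi * \<i> * deriv F ?z"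
    unfolding Cauchy_in(1)[OF d] by simp
  also have "deriv F ?z = of_real (slice_quot F q)"
    using deriv_cnj_real[OF open_S F q_S(1)] sym True by (simp add: slice_quot_def)
  finally show ?thesis .
qed

end

end

section \<open>Small circles as slice cycles\<close>

lemma circlepath_winding_out:
  assumes "0 < R" "z \<notin> cball c R"
  shows "winding_number (circlepath c R) z = 0"
  by (rule winding_number_zero_outside[of _ "cball c R"])
     (use assms in \<open>auto simp: path_image_circlepath\<close>)

lemma local_slice_cycle:
  assumes S: "open S" "cnj ` S \<subseteq> S" and q0: "slice_coord q0 \<in> S"
  obtains cs R d where "R > 0" "d > 0" "\<And>q. q \<in> ball q0 d \<Longrightarrow> slice_cycle S (map (\<lambda>c. circlepath c R) cs) q"
proof -
  let ?z = "slice_coord q0"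
  have cS: "cnj ?z \<in> S"
    using S q0 by blast
  obtain e1 where e1: "e1 > 0" "cball ?z e1 \<subseteq> S"
    using S q0 open_contains_cball by blast
  obtain e2 where e2: "e2 > 0" "cball (cnj ?z) e2 \<subseteq> S"
    using S cS open_contains_cball by blast
  \<comment> \<open>At a nonreal point the bound r/2 keeps the discs about z and its conjugate on
    opposite sides of the real axis, so each point is encircled by its own circle only. At a real
    point the discs coincide and the value 1 is arbitrary.\<close>
  define R where "R = min (min e1 e2) (if snd q0 = 0 then 1 else norm (snd q0) / 2)"
  have R: "R > 0" "cball ?z R \<subseteq> S" "cball (cnj ?z) R \<subseteq> S" "snd q0 \<noteq> 0 \<Longrightarrow> R < norm (snd q0)"
    using e1 e2 by (auto simp: R_def min_def split: if_splits)
  have "isCont slice_coord q0"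
    using continuous_on_slice_coord[of UNIV] continuous_on_eq_continuous_at[OF open_UNIV] by blast
  then obtain d where d: "d > 0" "\<And>q. dist q q0 < d \<Longrightarrow> dist (slice_coord q) ?z < R"
    using R(1) unfolding continuous_at_eps_delta by blast
  have near: "slice_coord q \<in> ball ?z R" "cnj (slice_coord q) \<in> ball (cnj ?z) R" if "q \<in> ball q0 d" for q
    using d(2)[of q] that complex_mod_cnj[of "?z - slice_coord q"]
    by (auto simp: dist_commute dist_norm)
  show ?thesis
  proof (cases "snd q0 = 0")
    case True
    then have z: "cnj ?z = ?z"
      by (simp add: complex_eq_iff)
    \<comment> \<open>A single circle here: listing the coinciding conjugate circle too would give
      winding sum 2.\<close>
    have "slice_cycle S (map (\<lambda>c. circlepath c R) [?z]) q" if "q \<in> ball q0 d" for q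
    proof
      show "open S" "slice_coord q \<in> S" "cnj (slice_coord q) \<in> S"
        using S near[OF that] R by auto
      show "valid_path \<gamma> \<and> pathfinish \<gamma> = pathstart \<gamma> \<and> path_image \<gamma> \<subseteq> S - {slice_coord q, cnj (slice_coord q)}"
        if "\<gamma> \<in> set (map (\<lambda>c. circlepath c R) [?z])" for \<gamma>
        using that near[OF \<open>q \<in> ball q0 d\<close>] R by (auto simp: path_image_circlepath z)
      show "(\<Sum>\<gamma>\<leftarrow>map (\<lambda>c. circlepath c R) [?z]. winding_number \<gamma> w) = 0" if "w \<notin> S" for w
        using circlepath_winding_out[OF R(1), of w ?z] contra_subsetD[OF R(2) that] by simp
      show "(\<Sum>\<gamma>\<leftarrow>map (\<lambda>c. circlepath c R) [?z]. winding_number \<gamma> (slice_coord q)) = 1"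
        "(\<Sum>\<gamma>\<leftarrow>map (\<lambda>c. circlepath c R) [?z]. winding_number \<gamma> (cnj (slice_coord q))) = 1"
        using near[OF that] by (auto simp: z dist_norm norm_minus_commute intro!: winding_number_circlepath)
    qed
    then show ?thesis
      using R(1) d(1) that by blast
  next
    case False
    have im: "Im w > 0" if "w \<in> cball ?z R" for w
      using abs_Im_le_cmod[of "?z - w"] that R(4)[OF False] by (auto simp: dist_norm)
    have im': "Im w < 0" if "w \<in> cball (cnj ?z) R" for w
      using abs_Im_le_cmod[of "cnj ?z - w"] that R(4)[OF False] by (auto simp: dist_norm)
    have disj: "w \<notin> cball (cnj ?z) R" if "w \<in> cball ?z R" for w
      using im[OF that] im'[of w] by auto
    have "slice_cycle S (map (\<lambda>c. circlepath c R) [?z, cnj ?z]) q" if "q \<in> ball q0 d" for q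
    proof
      have mem: "slice_coord q \<in> cball ?z R" "cnj (slice_coord q) \<in> cball (cnj ?z) R"
        using near[OF that] by auto
      show "open S" "slice_coord q \<in> S" "cnj (slice_coord q) \<in> S"
        using S mem R by auto
      show "valid_path \<gamma> \<and> pathfinish \<gamma> = pathstart \<gamma> \<and> path_image \<gamma> \<subseteq> S - {slice_coord q, cnj (slice_coord q)}"
        if "\<gamma> \<in> set (map (\<lambda>c. circlepath c R) [?z, cnj ?z])" for \<gamma>
      proof -
        have "sphere ?z R \<subseteq> S - {slice_coord q, cnj (slice_coord q)}" "sphere (cnj ?z) R \<subseteq> S - {slice_coord q, cnj (slice_coord q)}"
          using near[OF \<open>q \<in> ball q0 d\<close>] mem disj R by fastforce+
        then show ?thesis
          using that R(1) by auto
      qed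
      show "(\<Sum>\<gamma>\<leftarrow>map (\<lambda>c. circlepath c R) [?z, cnj ?z]. winding_number \<gamma> w) = 0" if "w \<notin> S" for w
        using circlepath_winding_out[OF R(1), of w] contra_subsetD[OF R(2) that] contra_subsetD[OF R(3) that] by simp
      have "winding_number (circlepath ?z R) (slice_coord q) = 1"
        "winding_number (circlepath (cnj ?z) R) (cnj (slice_coord q)) = 1"
        using near[OF that] by (auto simp: dist_norm norm_minus_commute intro!: winding_number_circlepath)
      moreover have "winding_number (circlepath ?z R) (cnj (slice_coord q)) = 0"
        "winding_number (circlepath (cnj ?z) R) (slice_coord q) = 0"
        using mem disj R(1) circlepath_winding_out by blast+
      ultimately show "(\<Sum>\<gamma>\<leftarrow>map (\<lambda>c. circlepath c R) [?z, cnj ?z]. winding_number \<gamma> (slice_coord q)) = 1"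
        "(\<Sum>\<gamma>\<leftarrow>map (\<lambda>c. circlepath c R) [?z, cnj ?z]. winding_number \<gamma> (cnj (slice_coord q))) = 1"
        by auto
    qed
    then show ?thesis
      using R(1) d(1) that by blast
  qed
qed

section \<open>Slice functions\<close>

lemma moment_system_zero: "open V \<Longrightarrow> moment_system V (\<lambda>j k q. 0)"
  by unfold_locales auto

lemma moment_system_add:
  assumes "moment_system V M" "moment_system V M'"
  shows "moment_system V (\<lambda>j k q. M j k q + M' j k q)"
proof
  show "open V"
    using assms(1) by (rule moment_system.open_V)
next
  fix q j k assume q: "q \<in> V"
  show "((\<lambda>q. M j k q + M' j k q) has_derivative
      (\<lambda>v. fst v *\<^sub>R ((2 * real k) *\<^sub>R (M (Suc j) (Suc k) q + M' (Suc j) (Suc k) q) - real j *\<^sub>R (M (j - 1) k q + M' (j - 1) k q))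
           - (2 * real k * (snd q \<bullet> snd v)) *\<^sub>R (M j (Suc k) q + M' j (Suc k) q))) (at q)"
    by (rule has_derivative_eq_rhs[OF has_derivative_add[OF
          moment_system.M_deriv[OF assms(1) q] moment_system.M_deriv[OF assms(2) q]]])
       (simp add: fun_eq_iff algebra_simps)
  show "M (Suc (Suc j)) (Suc k) q + M' (Suc (Suc j)) (Suc k) q + (snd q \<bullet> snd q) *\<^sub>R (M j (Suc k) q + M' j (Suc k) q)
     = M j k q + M' j k q"
    by (simp flip: moment_system.M_reduce[OF assms(1) q, of j k] moment_system.M_reduce[OF assms(2) q, of j k]
        add: algebra_simps)
qed

lemma moment_system_sum_list:
  assumes "open V" "\<And>x. x \<in> set xs \<Longrightarrow> moment_system V (M x)"
  shows "moment_system V (\<lambda>j k q. \<Sum>x\<leftarrow>xs. M x j k q)"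
  using assms(2) by (induction xs) (auto intro: moment_system_zero[OF assms(1)] moment_system_add)

lemma moment_system_sum:
  assumes "open V" "\<And>x. x \<in> A \<Longrightarrow> moment_system V (M x)"
  shows "moment_system V (\<lambda>j k q. \<Sum>x\<in>A. M x j k q)"
  using assms(2)
  by (induction A rule: infinite_finite_induct)
     (auto intro: moment_system_zero[OF assms(1)] moment_system_add)

text \<open>Both laws have real coefficients, so they survive multiplication by \<open>c\<close>,
  passage to the real part and scaling of a fixed quaternion \<open>e\<close>.\<close>

lemma moment_system_moment:
  assumes "open V" "convex V" "continuous_on {0..1} \<gamma>" "continuous_on {0..1} \<omega>"
    and "\<And>q t. q \<in> V \<Longrightarrow> t \<in> {0..1} \<Longrightarrow> slice_den q (\<gamma> t) \<noteq> 0"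
  shows "moment_system V (\<lambda>j k q. Re (c * moment \<gamma> \<omega> j k q) *\<^sub>R e)"
proof
  fix q j k assume q: "q \<in> V"
  show "((\<lambda>q. Re (c * moment \<gamma> \<omega> j k q) *\<^sub>R e) has_derivative
      (\<lambda>v. fst v *\<^sub>R ((2 * real k) *\<^sub>R (Re (c * moment \<gamma> \<omega> (Suc j) (Suc k) q) *\<^sub>R e) - real j *\<^sub>R (Re (c * moment \<gamma> \<omega> (j - 1) k q) *\<^sub>R e))
           - (2 * real k * (snd q \<bullet> snd v)) *\<^sub>R (Re (c * moment \<gamma> \<omega> j (Suc k) q) *\<^sub>R e))) (at q)"
    by (rule has_derivative_eq_rhs[OF has_derivative_scaleR_left[OF bounded_linear.has_derivative[OF bounded_linear_Re
          has_derivative_mult_right[OF moment_has_derivative[OF assms(1,2) q assms(3,4,5)]]]]])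
       (auto simp: fun_eq_iff algebra_simps)
  show "Re (c * moment \<gamma> \<omega> (Suc (Suc j)) (Suc k) q) *\<^sub>R e + (snd q \<bullet> snd q) *\<^sub>R (Re (c * moment \<gamma> \<omega> j (Suc k) q) *\<^sub>R e)
      = Re (c * moment \<gamma> \<omega> j k q) *\<^sub>R e"
  proof -
    have "c * moment \<gamma> \<omega> (Suc (Suc j)) (Suc k) q + of_real (snd q \<bullet> snd q) * (c * moment \<gamma> \<omega> j (Suc k) q)
        = c * moment \<gamma> \<omega> j k q"
      using moment_reduce[OF assms(3,4) assms(5)[OF q], of j k] by (metis distrib_left mult.left_commute)
    then have "Re (c * moment \<gamma> \<omega> (Suc (Suc j)) (Suc k) q) + (snd q \<bullet> snd q) * Re (c * moment \<gamma> \<omega> j (Suc k) q)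
        = Re (c * moment \<gamma> \<omega> j k q)"
      by (metis plus_complex.sel(1) Re_complex_of_real Im_complex_of_real times_complex.sel(1) mult_zero_left diff_zero)
    then show ?thesis
      by (metis scaleR_left.add scaleR_scaleR)
  qed
qed (rule assms(1))

definition stem_comp :: "(real \<times> real \<Rightarrow> quat) \<Rightarrow> (real \<times> real \<Rightarrow> quat) \<Rightarrow> nat \<Rightarrow> complex \<Rightarrow> complex" where
  "stem_comp \<alpha> \<beta> i z = Complex (\<alpha> (Re z, Im z) \<bullet> qe i) (\<beta> (Re z, Im z) \<bullet> qe i)"

definition stem_quot :: "(real \<times> real \<Rightarrow> quat) \<Rightarrow> (real \<times> real \<Rightarrow> quat) \<Rightarrow> quat \<Rightarrow> quat" where
  "stem_quot \<alpha> \<beta> q = (\<Sum>i<4. slice_quot (stem_comp \<alpha> \<beta> i) q *\<^sub>R qe i)"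

lemma quat_expand: "(\<Sum>i<4. (p \<bullet> qe i) *\<^sub>R qe i) = p"
proof -
  have "{..<4::nat} = {0,1,2,3}"
    by auto
  then show ?thesis
    by (cases p) (simp add: qe_def)
qed

section \<open>Slices as embedded complex planes\<close>

lemma qsphereE:
  assumes "J \<in> qsphere"
  obtains a b c where "J = (0, a, b, c)" "a * a + b * b + c * c = 1"
  using assms by (cases J) (auto simp: qsphere_def qRe_def norm_Pair power2_eq_square add.assoc)

lemma qe_in_qsphere: "qe 1 \<in> qsphere"
  by (simp add: qsphere_def qRe_def qe_def norm_Pair)

lemma minus_in_qsphere: "J \<in> qsphere \<Longrightarrow> - J \<in> qsphere"
  by (simp add: qsphere_def qRe_def)

lemma slice_polar:
  obtains I where "I \<in> qsphere" "q = slice_pt (fst q) (norm (snd q)) I" "qim q = norm (snd q) *\<^sub>R I"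
proof (cases "snd q = 0")
  case True
  then show ?thesis
    using that[OF qe_in_qsphere]
    by (cases q) (auto simp: slice_pt_def qreal_def qim_def zero_prod_def)
next
  case False
  let ?I = "(0, (1 / norm (snd q)) *\<^sub>R snd q)"
  have "?I \<in> qsphere"
    using False by (simp add: qsphere_def qRe_def norm_Pair)
  moreover have "q = slice_pt (fst q) (norm (snd q)) ?I" "qim q = norm (snd q) *\<^sub>R ?I"
    using False by (cases q; simp add: slice_pt_def qreal_def qim_def zero_prod_def[symmetric])+
  ultimately show ?thesis
    using that by blast
qed

lemma bounded_linear_embJ: "bounded_linear (embJ J)"
  unfolding linear_conv_bounded_linear[symmetric] linear_iff
  by (auto simp: embJ_def slice_pt_def qreal_def algebra_simps prod_eq_iff)

text \<open>Because \<open>J\<close> squares to -1, \<open>embJ J\<close> is a ring embedding of the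
  complex numbers; computations within one slice become commutative.\<close>

lemma embJ_mult:
  assumes "J \<in> qsphere"
  shows "embJ J (z * w) = embJ J z \<odot> embJ J w"
proof -
  obtain a b c where J: "J = (0, a, b, c)" "a * a + b * b + c * c = 1"
    using assms by (rule qsphereE)
  have "Im z * Im w = Im z * Im w * (a * a + b * b + c * c)"
    using J by simp
  then show ?thesis
    by (simp add: embJ_def slice_pt_def qreal_def J(1) qmult_def algebra_simps)
qed

lemma embJ_of_real [simp]: "embJ J (of_real r) = qreal r"
  by (simp add: embJ_def slice_pt_def)

lemma norm_embJ:
  assumes "J \<in> qsphere"
  shows "norm (embJ J z) = norm z"
proof -
  obtain a b c where J: "J = (0, a, b, c)" "a * a + b * b + c * c = 1"
    using assms by (rule qsphereE)
  have "(Re z)\<^sup>2 + (Im z)\<^sup>2 * (a * a + b * b + c * c) = (Re z)\<^sup>2 + (Im z)\<^sup>2"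
    using J by simp
  then have "(norm (embJ J z))\<^sup>2 = (norm z)\<^sup>2"
    unfolding power2_norm_eq_inner
    by (simp add: embJ_def slice_pt_def qreal_def J(1) inner_complex_def power2_eq_square algebra_simps)
  then show ?thesis
    by (simp add: power2_eq_iff_nonneg)
qed

lemma qinv_embJ:
  assumes "J \<in> qsphere"
  shows "qinv (embJ J z) = embJ J (inverse z)"
proof -
  obtain a b c where J: "J = (0, a, b, c)"
    using assms by (rule qsphereE)
  have "inverse z = (1 / (norm z)\<^sup>2) *\<^sub>R cnj z"
    by (simp add: complex_eq_iff cmod_power2)
  then show ?thesis
    unfolding qinv_def norm_embJ[OF assms]
    by (simp add: linear_simps[OF bounded_linear_embJ])
       (simp add: embJ_def slice_pt_def qreal_def J qconj_def)
qed

text \<open>\<open>Qcs\<close> depends on \<open>q\<close> only through its real part and modulus,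
  so for \<open>s\<close> in the slice of \<open>J\<close> it stays in that slice even when
  \<open>q\<close> does not lie there.\<close>

lemma Qcs_embJ:
  assumes "J \<in> qsphere"
  shows "Qcs q (embJ J s) = embJ J (slice_den q s)"
proof -
  have "(norm q)\<^sup>2 = (fst q)\<^sup>2 + snd q \<bullet> snd q"
    by (simp add: dot_square_norm norm_prod_def)
  then have "slice_den q s = s * s - (2 * fst q) *\<^sub>R s + of_real ((norm q)\<^sup>2)"
    by (simp add: slice_den_def power2_eq_square scaleR_conv_of_real algebra_simps)
  then show ?thesis
    by (simp add: Qcs_def qRe_def linear_simps[OF bounded_linear_embJ] embJ_mult[OF assms] del: of_real_power)
qed

lemma qmult_assoc: "p \<odot> q \<odot> r = p \<odot> (q \<odot> r)"
  by (cases p; cases q; cases r) (simp add: qmult_def algebra_simps)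

lemma qreal_qmult: "qreal r \<odot> p = r *\<^sub>R p" "p \<odot> qreal r = r *\<^sub>R p"
  by (cases p; simp add: qreal_def qmult_def)+

lemma slice_part_cnj:
  assumes "axially_symmetric A" "J \<in> qsphere" "z \<in> slice_part A J"
  shows "cnj z \<in> slice_part A J"
proof -
  have "embJ J (cnj z) = slice_pt (Re z) (Im z) (- J)"
    by (simp add: embJ_def slice_pt_def)
  then show ?thesis
    using assms minus_in_qsphere[OF assms(2)]
    unfolding slice_part_def axially_symmetric_def mem_Collect_eq by (metis embJ_def)
qed

lemma slice_coord_in_slice_part:
  assumes "axially_symmetric A" "J \<in> qsphere"
  shows "slice_coord q \<in> slice_part A J \<longleftrightarrow> q \<in> A"
proof -
  obtain I where I: "I \<in> qsphere" "q = slice_pt (fst q) (norm (snd q)) I"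
    by (rule slice_polar)
  have "slice_pt (fst q) (norm (snd q)) J \<in> A \<longleftrightarrow> slice_pt (fst q) (norm (snd q)) I \<in> A"
    using assms I(1) unfolding axially_symmetric_def by blast
  then show ?thesis
    using I(2) by (simp add: slice_part_def embJ_def)
qed

lemma slice_dom_iff:
  assumes "axially_symmetric A" "J \<in> qsphere"
  shows "(Re z, Im z) \<in> slice_dom A \<longleftrightarrow> z \<in> slice_part A J"
  using assms unfolding slice_dom_def slice_part_def embJ_def axially_symmetric_def by blast

lemma slice_part_vimage: "slice_part A J = embJ J -` A"
  by (auto simp: slice_part_def)

lemma open_slice_part: "open A \<Longrightarrow> open (slice_part A J)"
  unfolding slice_part_vimage
  by (rule open_vimage[OF _ linear_continuous_on[OF bounded_linear_embJ]])

lemma closure_slice_part: "closure (slice_part A J) \<subseteq> slice_part (closure A) J"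
proof (rule closure_minimal)
  show "closed (slice_part (closure A) J)"
    unfolding slice_part_vimage
    by (rule closed_vimage[OF closed_closure linear_continuous_on[OF bounded_linear_embJ]])
qed (use closure_subset in \<open>auto simp: slice_part_def\<close>)

text \<open>Left and right slice hyperholomorphic functions share this structure; they differ only
  in the side on which \<open>J\<close> multiplies \<beta>.\<close>

locale slice_stem =
  fixes W :: "quat set" and \<alpha> \<beta> :: "real \<times> real \<Rightarrow> quat"
  assumes open_W: "open W" and axial_W: "axially_symmetric W" and stem: "slice_stem_ok W \<alpha> \<beta>"
begin

text \<open>The two equations in \<open>slice_stem_ok\<close> are the Cauchy-Riemann equations of
  each component, so its real derivative is multiplication by a complex number.\<close>

lemma stem_comp_holomorphic:
  assumes "J \<in> qsphere"
  shows "stem_comp \<alpha> \<beta> i holomorphic_on slice_part W J"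
proof (rule holomorphic_onI)
  fix z assume "z \<in> slice_part W J"
  then have "(Re z, Im z) \<in> slice_dom W"
    using slice_dom_iff[OF axial_W assms] by blast
  then obtain \<alpha>' \<beta>' where d: "(\<alpha> has_derivative \<alpha>') (at (Re z, Im z))" "(\<beta> has_derivative \<beta>') (at (Re z, Im z))"
    and CR: "\<alpha>' (1, 0) - \<beta>' (0, 1) = 0" "\<alpha>' (0, 1) + \<beta>' (1, 0) = 0"
    using stem unfolding slice_stem_ok_def by blast
  have lin: "g (x, y) = x *\<^sub>R g (1, 0) + y *\<^sub>R g (0, 1)"
    if "(h has_derivative g) (at p)" for h :: "real \<times> real \<Rightarrow> quat" and g p x y
  proof -
    have g: "linear g"
      using that has_derivative_linear by blast
    then have "g (x *\<^sub>R (1, 0) + y *\<^sub>R (0, 1)) = x *\<^sub>R g (1, 0) + y *\<^sub>R g (0, 1)"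
      by (simp only: linear_add[OF g] linear_scale[OF g])
    then show ?thesis
      by simp
  qed
  have ri: "((\<lambda>z. (Re z, Im z)) has_derivative (\<lambda>v. (Re v, Im v))) (at z)"
    by (intro derivative_intros)
  have comp: "((\<lambda>z. h (Re z, Im z) \<bullet> qe i) has_derivative (\<lambda>v. g (Re v, Im v) \<bullet> qe i)) (at z)"
    if "(h has_derivative g) (at (Re z, Im z))" for h :: "real \<times> real \<Rightarrow> quat" and g
    using has_derivative_inner_left[OF diff_chain_at[OF ri that]] by (simp add: o_def)
  have "(stem_comp \<alpha> \<beta> i has_derivative
      (\<lambda>v. of_real (\<alpha>' (Re v, Im v) \<bullet> qe i) + \<i> * of_real (\<beta>' (Re v, Im v) \<bullet> qe i))) (at z)"
    unfolding stem_comp_def[abs_def] Complex_eq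
    by (intro has_derivative_add has_derivative_mult_right has_derivative_of_real comp d)
  moreover have "of_real (\<alpha>' (Re v, Im v) \<bullet> qe i) + \<i> * of_real (\<beta>' (Re v, Im v) \<bullet> qe i)
      = Complex (\<alpha>' (1, 0) \<bullet> qe i) (\<beta>' (1, 0) \<bullet> qe i) * v" for v
  proof -
    have CR': "\<beta>' (0, 1) = \<alpha>' (1, 0)" "\<alpha>' (0, 1) = - \<beta>' (1, 0)"
      using CR by (simp_all add: eq_neg_iff_add_eq_0)
    show ?thesis
      unfolding lin[OF d(1), of "Re v" "Im v"] lin[OF d(2), of "Re v" "Im v"] CR'
      by (simp add: complex_eq_iff inner_left_distrib inner_diff_left)
  qed
  ultimately have "(stem_comp \<alpha> \<beta> i has_derivative
      (*) (Complex (\<alpha>' (1, 0) \<bullet> qe i) (\<beta>' (1, 0) \<bullet> qe i))) (at z)"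
    by simp
  then have "(stem_comp \<alpha> \<beta> i has_field_derivative Complex (\<alpha>' (1, 0) \<bullet> qe i) (\<beta>' (1, 0) \<bullet> qe i)) (at z)"
    by (simp add: has_field_derivative_def)
  then show "stem_comp \<alpha> \<beta> i field_differentiable at z within slice_part W J"
    using field_differentiable_at_within field_differentiable_def by blast
qed

lemma stem_comp_cnj:
  assumes "J \<in> qsphere" "z \<in> slice_part W J"
  shows "stem_comp \<alpha> \<beta> i (cnj z) = cnj (stem_comp \<alpha> \<beta> i z)"
  using stem slice_dom_iff[OF axial_W assms(1)] assms(2)
  by (auto simp: slice_stem_ok_def stem_comp_def complex_eq_iff)

lemma scaled_stem_quot:
  assumes "q \<in> W"
  shows "norm (snd q) *\<^sub>R stem_quot \<alpha> \<beta> q = \<beta> (fst q, norm (snd q))"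
proof (cases "snd q = 0")
  case True
  have "(fst q, 0) \<in> slice_dom W"
    using slice_dom_iff[OF axial_W qe_in_qsphere, of "slice_coord q"]
      slice_coord_in_slice_part[OF axial_W qe_in_qsphere] assms True by simp
  \<comment> \<open>Oddness in the second variable forces \<beta> to vanish on the real axis, so
    both sides are 0 there.\<close>
  then have "\<beta> (fst q, - 0) = - \<beta> (fst q, 0)"
    using stem unfolding slice_stem_ok_def by blast
  then have "2 *\<^sub>R \<beta> (fst q, 0) = 0"
    by (simp add: scaleR_2 eq_neg_iff_add_eq_0)
  then have "\<beta> (fst q, 0) = 0"
    by simp
  then show ?thesis
    using True by simp
next
  case False
  then have "norm (snd q) *\<^sub>R stem_quot \<alpha> \<beta> q = (\<Sum>i<4. (\<beta> (fst q, norm (snd q)) \<bullet> qe i) *\<^sub>R qe i)"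
    unfolding stem_quot_def scaleR_sum_right by (intro sum.cong) (auto simp: slice_quot_def stem_comp_def)
  then show ?thesis
    by (simp add: quat_expand)
qed

text \<open>Circles chosen at \<open>q0\<close> wind correctly about all nearby \<open>q\<close> and
  their conjugates. Cauchy's formula over these fixed circles writes \<alpha> as the moment with
  exponents 1, 1 and \<beta> / r as the one with exponents 0, 1, which can be differentiated under
  the integral sign.\<close>

lemma local_moments:
  assumes "q0 \<in> W"
  obtains V M where "moment_system V M" "q0 \<in> V" "V \<subseteq> W"
    "\<And>q. q \<in> V \<Longrightarrow> M (Suc 0) (Suc 0) q = \<alpha> (fst q, norm (snd q))"
    "\<And>q. q \<in> V \<Longrightarrow> M 0 (Suc 0) q = stem_quot \<alpha> \<beta> q"
proof -
  define S where "S = slice_part W (qe 1)"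
  have S: "open S" "cnj ` S \<subseteq> S" "slice_coord q0 \<in> S"
    using open_slice_part[OF open_W] slice_part_cnj[OF axial_W qe_in_qsphere] assms
      slice_coord_in_slice_part[OF axial_W qe_in_qsphere] by (auto simp: S_def)
  define F where "F = stem_comp \<alpha> \<beta>"
  have F: "F i holomorphic_on S" "\<And>s. s \<in> S \<Longrightarrow> F i (cnj s) = cnj (F i s)" for i
    using stem_comp_holomorphic[OF qe_in_qsphere] stem_comp_cnj[OF qe_in_qsphere] by (auto simp: S_def F_def)
  obtain cs R d where R: "R > 0" "d > 0"
    and cyc: "\<And>q. q \<in> ball q0 d \<Longrightarrow> slice_cycle S (map (\<lambda>c. circlepath c R) cs) q"
    using local_slice_cycle[OF S] by blast
  define \<Gamma> where "\<Gamma> = map (\<lambda>c. circlepath c R) cs"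
  define \<omega> where "\<omega> \<gamma> i t = F i (\<gamma> t) * vector_derivative \<gamma> (at t)" for \<gamma> i t
  \<comment> \<open>The constant cancels the Cauchy factor; for the exponents used below the result
    is real, so \<open>Re\<close> only changes the type.\<close>
  define M where "M j k q = (\<Sum>i<4. \<Sum>\<gamma>\<leftarrow>\<Gamma>. Re (1 / (2 * pi * \<i>) * moment \<gamma> (\<omega> \<gamma> i) j k q) *\<^sub>R qe i)" for j k q
  have M1: "M j (Suc 0) q = (\<Sum>i<4. Re (1 / (2 * pi * \<i>) * (\<Sum>\<gamma>\<leftarrow>\<Gamma>. contour_integral \<gamma> (\<lambda>s. slice_ker j (Suc 0) q s * F i s))) *\<^sub>R qe i)" for j q
  proof -
    have "moment \<gamma> (\<omega> \<gamma> i) j k q = contour_integral \<gamma> (\<lambda>s. slice_ker j k q s * F i s)" for \<gamma> i k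
      by (simp add: moment_def contour_integral_integral \<omega>_def mult.assoc)
    moreover have "(\<Sum>\<gamma>\<leftarrow>\<Gamma>. Re (c * g \<gamma>) *\<^sub>R e) = Re (c * (\<Sum>\<gamma>\<leftarrow>\<Gamma>. g \<gamma>)) *\<^sub>R e" for c g and e :: quat
      by (induction \<Gamma>) (auto simp: algebra_simps)
    ultimately show ?thesis
      by (simp only: M_def)
  qed
  have "moment_system (ball q0 d) M"
    unfolding M_def
  proof (intro moment_system_sum moment_system_sum_list moment_system_moment)
    fix i \<gamma> assume \<gamma>: "\<gamma> \<in> set \<Gamma>"
    have v: "path_image \<gamma> \<subseteq> S - {slice_coord q, cnj (slice_coord q)}" if "q \<in> ball q0 d" for q
      using slice_cycle.cycle[OF cyc[OF that, folded \<Gamma>_def] \<gamma>] by blast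
    obtain c where c: "\<gamma> = circlepath c R"
      using \<gamma> by (auto simp: \<Gamma>_def)
    show cont: "continuous_on {0..1} \<gamma>"
      using c by (metis path_circlepath path_def)
    have "continuous_on {0..1} (\<lambda>t. F i (\<gamma> t))"
      by (rule continuous_on_compose2[OF holomorphic_on_imp_continuous_on[OF F(1)] cont])
         (use v[of q0] R in \<open>auto simp: path_image_def\<close>)
    \<comment> \<open>A circle has an explicit continuous velocity, whereas that of a merely
      piecewise smooth loop may jump.\<close>
    then show "continuous_on {0..1} (\<omega> \<gamma> i)"
      unfolding \<omega>_def c vector_derivative_circlepath by (auto intro!: continuous_intros)
    show "slice_den q (\<gamma> t) \<noteq> 0" if "q \<in> ball q0 d" "t \<in> {0..1}" for q t
    proof -
      have "\<gamma> t \<in> path_image \<gamma>"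
        using that(2) by (auto simp: path_image_def)
      then show ?thesis
        using v[OF that(1)] by (auto simp: slice_den_factor)
    qed
  qed auto
  moreover have "ball q0 d \<subseteq> W"
    using slice_cycle.q_S(1)[OF cyc] slice_coord_in_slice_part[OF axial_W qe_in_qsphere] by (auto simp: S_def)
  moreover have "M (Suc 0) (Suc 0) q = \<alpha> (fst q, norm (snd q))" if "q \<in> ball q0 d" for q
  proof -
    have "(\<Sum>\<gamma>\<leftarrow>\<Gamma>. contour_integral \<gamma> (\<lambda>s. slice_ker (Suc 0) (Suc 0) q s * F i s))
        = 2 * pi * \<i> * of_real (Re (F i (slice_coord q)))" for i
      by (rule slice_cycle.integral_slice_ker_1_1[OF cyc[OF that, folded \<Gamma>_def] F])
    then have "M (Suc 0) (Suc 0) q = (\<Sum>i<4. (\<alpha> (fst q, norm (snd q)) \<bullet> qe i) *\<^sub>R qe i)"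
      by (simp add: M1) (simp add: F_def stem_comp_def)
    then show ?thesis
      by (simp add: quat_expand)
  qed
  moreover have "M 0 (Suc 0) q = stem_quot \<alpha> \<beta> q" if "q \<in> ball q0 d" for q
  proof -
    have "(\<Sum>\<gamma>\<leftarrow>\<Gamma>. contour_integral \<gamma> (\<lambda>s. slice_ker 0 (Suc 0) q s * F i s))
        = 2 * pi * \<i> * of_real (slice_quot (F i) q)" for i
      by (rule slice_cycle.integral_slice_ker_0_1[OF cyc[OF that, folded \<Gamma>_def] F])
    then show ?thesis
      by (simp add: M1) (simp add: F_def stem_quot_def)
  qed
  ultimately show ?thesis
    using that[of "ball q0 d" M] R(2) by simp
qed

lemma harmonic_stem_quot: "harmonic_on W (\<lambda>q. c *\<^sub>R stem_quot \<alpha> \<beta> q)"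
proof (rule harmonic_on_local)
  fix q assume "q \<in> W"
  then obtain V M where V: "moment_system V M" "q \<in> V" "\<And>q. q \<in> V \<Longrightarrow> M 0 (Suc 0) q = stem_quot \<alpha> \<beta> q"
    by (rule local_moments) blast
  then show "\<exists>V h. open V \<and> q \<in> V \<and> (\<forall>x\<in>V. c *\<^sub>R stem_quot \<alpha> \<beta> x = h x) \<and> harmonic_on V h"
    using moment_system.harmonic_on_M[OF V(1), of c] moment_system.open_V[OF V(1)]
    by (intro exI[of _ V] exI[of _ "\<lambda>q. c *\<^sub>R M 0 (Suc 0) q"]) simp
qed

text \<open>With \<open>I\<close> the direction of the imaginary part, \<open>I\<close> \<beta>
  equals (r \<open>I\<close>) (\<beta> / r), and r \<open>I\<close> is \<open>qim x\<close>. So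
  \<open>f\<close> is locally the moment expression already differentiated, also on the real axis,
  where the choice of \<open>I\<close> is immaterial.\<close>

lemma fueter_left_stem:
  assumes f: "\<And>u v J. J \<in> qsphere \<Longrightarrow> slice_pt u v J \<in> W \<Longrightarrow> f (slice_pt u v J) = \<alpha> (u, v) + J \<odot> \<beta> (u, v)"
    and "q \<in> W"
  shows "fueter_left f q = (-2) *\<^sub>R stem_quot \<alpha> \<beta> q"
proof -
  obtain V M where V: "moment_system V M" "q \<in> V" "V \<subseteq> W"
      and M: "\<And>q. q \<in> V \<Longrightarrow> M (Suc 0) (Suc 0) q = \<alpha> (fst q, norm (snd q))"
        "\<And>q. q \<in> V \<Longrightarrow> M 0 (Suc 0) q = stem_quot \<alpha> \<beta> q"
    using local_moments[OF \<open>q \<in> W\<close>] by blast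
  have "f x = M (Suc 0) (Suc 0) x + qim x \<odot> M 0 (Suc 0) x" if "x \<in> V" for x
  proof -
    have "x \<in> W"
      using that V by blast
    obtain I where I: "I \<in> qsphere" "x = slice_pt (fst x) (norm (snd x)) I" "qim x = norm (snd x) *\<^sub>R I"
      by (rule slice_polar)
    have "f x = \<alpha> (fst x, norm (snd x)) + I \<odot> \<beta> (fst x, norm (snd x))"
      using f[OF I(1), of "fst x" "norm (snd x)"] I(2) \<open>x \<in> W\<close> by metis
    also have "I \<odot> \<beta> (fst x, norm (snd x)) = qim x \<odot> stem_quot \<alpha> \<beta> x"
      unfolding scaled_stem_quot[OF \<open>x \<in> W\<close>, symmetric] I(3)
      by (simp add: bounded_bilinear.scaleR_left[OF bounded_bilinear_qmult]
          bounded_bilinear.scaleR_right[OF bounded_bilinear_qmult])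
    finally show ?thesis
      by (simp add: M that)
  qed
  then have "fueter_left f q = fueter_left (\<lambda>x. M (Suc 0) (Suc 0) x + qim x \<odot> M 0 (Suc 0) x) q"
    by (rule fueter_left_cong_open[OF moment_system.open_V[OF V(1)] V(2)])
  then show ?thesis
    by (simp only: moment_system.fueter_left_M[OF V(1,2)] M(2)[OF V(2)])
qed

lemma fueter_right_stem:
  assumes f: "\<And>u v J. J \<in> qsphere \<Longrightarrow> slice_pt u v J \<in> W \<Longrightarrow> f (slice_pt u v J) = \<alpha> (u, v) + \<beta> (u, v) \<odot> J"
    and "q \<in> W"
  shows "fueter_right f q = (-2) *\<^sub>R stem_quot \<alpha> \<beta> q"
proof -
  obtain V M where V: "moment_system V M" "q \<in> V" "V \<subseteq> W"
      and M: "\<And>q. q \<in> V \<Longrightarrow> M (Suc 0) (Suc 0) q = \<alpha> (fst q, norm (snd q))"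
        "\<And>q. q \<in> V \<Longrightarrow> M 0 (Suc 0) q = stem_quot \<alpha> \<beta> q"
    using local_moments[OF \<open>q \<in> W\<close>] by blast
  have "f x = M (Suc 0) (Suc 0) x + M 0 (Suc 0) x \<odot> qim x" if "x \<in> V" for x
  proof -
    have "x \<in> W"
      using that V by blast
    obtain I where I: "I \<in> qsphere" "x = slice_pt (fst x) (norm (snd x)) I" "qim x = norm (snd x) *\<^sub>R I"
      by (rule slice_polar)
    have "f x = \<alpha> (fst x, norm (snd x)) + \<beta> (fst x, norm (snd x)) \<odot> I"
      using f[OF I(1), of "fst x" "norm (snd x)"] I(2) \<open>x \<in> W\<close> by metis
    also have "\<beta> (fst x, norm (snd x)) \<odot> I = stem_quot \<alpha> \<beta> x \<odot> qim x"
      unfolding scaled_stem_quot[OF \<open>x \<in> W\<close>, symmetric] I(3)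
      by (simp add: bounded_bilinear.scaleR_left[OF bounded_bilinear_qmult]
          bounded_bilinear.scaleR_right[OF bounded_bilinear_qmult])
    finally show ?thesis
      by (simp add: M that)
  qed
  then have "fueter_right f q = fueter_right (\<lambda>x. M (Suc 0) (Suc 0) x + M 0 (Suc 0) x \<odot> qim x) q"
    by (rule fueter_right_cong_open[OF moment_system.open_V[OF V(1)] V(2)])
  then show ?thesis
    by (simp only: moment_system.fueter_right_M[OF V(1,2)] M(2)[OF V(2)])
qed

end

section \<open>Boundary integrals\<close>

text \<open>Inside the slice, the measure ds(-J) becomes the complex differential times
  \<open>- \<i>\<close>.\<close>

lemma embJ_minus_ii: "embJ J (- \<i>) = - J"
  by (simp add: embJ_def slice_pt_def qreal_def zero_prod_def[symmetric])

context slice_stem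
begin

text \<open>Writes a slice function value as complex values in the slice of \<open>J\<close> with
  the basis elements on the far side, so that kernel, measure and stem component stand next to each
  other and commute.\<close>

lemma stem_comp_sum:
  assumes B: "bounded_bilinear B" "\<And>r p. B (qreal r) p = r *\<^sub>R p"
  shows "(\<Sum>i<4. B (embJ J (stem_comp \<alpha> \<beta> i z)) (qe i)) = \<alpha> (Re z, Im z) + B J (\<beta> (Re z, Im z))"
proof -
  have "B (embJ J w) e = Re w *\<^sub>R e + B J (Im w *\<^sub>R e)" for w e
    by (simp add: embJ_def slice_pt_def B(2) bounded_bilinear.add_left[OF B(1)]
        bounded_bilinear.scaleR_left[OF B(1)] bounded_bilinear.scaleR_right[OF B(1)])
  then have "(\<Sum>i<4. B (embJ J (stem_comp \<alpha> \<beta> i z)) (qe i))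
      = (\<Sum>i<4. (\<alpha> (Re z, Im z) \<bullet> qe i) *\<^sub>R qe i) + B J (\<Sum>i<4. (\<beta> (Re z, Im z) \<bullet> qe i) *\<^sub>R qe i)"
    by (simp add: stem_comp_def sum.distrib bounded_bilinear.sum_right[OF B(1)])
  then show ?thesis
    by (simp only: quat_expand)
qed

text \<open>Multiplying by a fixed basis element is real linear, so it can be pulled out of the
  integral; what remains are the complex contour integrals of
  \<open>integral_slice_ker_0_1\<close>.\<close>

lemma cycle_integral_stem:
  assumes J: "J \<in> qsphere" and cyc: "slice_cycle (slice_part W J) \<Gamma> q"
    and B: "bounded_bilinear B" "\<And>r p. B (qreal r) p = r *\<^sub>R p"
    and g: "\<And>\<gamma> t. \<gamma> \<in> set \<Gamma> \<Longrightarrow> t \<in> {0..1} \<Longrightarrow> \<gamma> t \<in> slice_part W J \<Longrightarrow>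
      g \<gamma> t = (\<Sum>i<4. B (embJ J (inverse (slice_den q (\<gamma> t)) * (vector_derivative \<gamma> (at t) * - \<i>)
        * stem_comp \<alpha> \<beta> i (\<gamma> t))) (qe i))"
  shows "(\<Sum>\<gamma>\<leftarrow>\<Gamma>. integral {0..1} (g \<gamma>)) = (2 * pi) *\<^sub>R stem_quot \<alpha> \<beta> q"
proof -
  interpret slice_cycle "slice_part W J" \<Gamma> q
    by (rule cyc)
  define F where "F = stem_comp \<alpha> \<beta>"
  note F = stem_comp_holomorphic[OF J, folded F_def] stem_comp_cnj[OF J, folded F_def]
  define k where "k i s = slice_ker 0 (Suc 0) q s * F i s" for i s
  define L where "L i w = B (embJ J (w * - \<i>)) (qe i)" for i w
  have L: "bounded_linear (L i)" for i
    unfolding L_def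
    by (rule bounded_linear_compose[OF bounded_linear_compose[OF bounded_bilinear.bounded_linear_left[OF B(1)] bounded_linear_embJ]
          bounded_linear_mult_left])
  have 1: "integral {0..1} (g \<gamma>) = (\<Sum>i<4. L i (contour_integral \<gamma> (k i)))" if "\<gamma> \<in> set \<Gamma>" for \<gamma>
  proof -
    let ?T = "slice_part W J - {slice_coord q, cnj (slice_coord q)}"
    have im: "\<gamma> t \<in> ?T" if "t \<in> {0..1}" for t
    proof -
      have "\<gamma> t \<in> path_image \<gamma>"
        using that by (auto simp: path_image_def)
      then show ?thesis
        using cycle[OF \<open>\<gamma> \<in> set \<Gamma>\<close>] by blast
    qed
    have "k i holomorphic_on ?T" for i
      unfolding k_def slice_ker_def slice_den_factor power_0 mult_1 power_Suc0_right
      by (intro holomorphic_intros holomorphic_on_subset[OF F(1)]) auto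
    then have "k i contour_integrable_on \<gamma>" for i
      using cycle[OF that] open_S
      by (intro contour_integrable_holomorphic_simple[of _ ?T]) auto
    then have int: "(\<lambda>t. k i (\<gamma> t) * vector_derivative \<gamma> (at t)) integrable_on {0..1}" for i
      by (simp add: contour_integrable_on)
    have "integral {0..1} (g \<gamma>) = integral {0..1} (\<lambda>t. \<Sum>i<4. L i (k i (\<gamma> t) * vector_derivative \<gamma> (at t)))"
    proof (rule integral_cong)
      fix t :: real assume t: "t \<in> {0..1}"
      show "g \<gamma> t = (\<Sum>i<4. L i (k i (\<gamma> t) * vector_derivative \<gamma> (at t)))"
        using g[OF that t] im[OF t] by (simp add: L_def k_def slice_ker_def F_def mult_ac)
    qed
    also have "\<dots> = (\<Sum>i<4. integral {0..1} (\<lambda>t. L i (k i (\<gamma> t) * vector_derivative \<gamma> (at t))))"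
      by (intro integral_sum finite_lessThan integrable_linear[OF int L, unfolded o_def])
    also have "\<dots> = (\<Sum>i<4. L i (contour_integral \<gamma> (k i)))"
      using integral_linear[OF int L] by (simp add: o_def contour_integral_integral)
    finally show ?thesis .
  qed
  have "(\<Sum>\<gamma>\<leftarrow>\<Gamma>. integral {0..1} (g \<gamma>)) = (\<Sum>\<gamma>\<leftarrow>\<Gamma>. \<Sum>i<4. L i (contour_integral \<gamma> (k i)))"
    by (rule arg_cong[of _ _ sum_list], rule map_cong[OF refl 1])
  also have "\<dots> = (\<Sum>i<4. L i (\<Sum>\<gamma>\<leftarrow>\<Gamma>. contour_integral \<gamma> (k i)))"
  proof (induction \<Gamma>)
    case (Cons \<gamma> \<Gamma>)
    then show ?case
      by (simp add: linear_simps[OF L] sum.distrib)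
  qed (simp add: linear_simps[OF L])
  also have "\<dots> = (\<Sum>i<4. L i (2 * pi * \<i> * of_real (slice_quot (F i) q)))"
    unfolding k_def by (intro sum.cong refl arg_cong[of _ _ "L _"] integral_slice_ker_0_1 F)
  also have "\<dots> = (\<Sum>i<4. (2 * pi) *\<^sub>R (slice_quot (F i) q *\<^sub>R qe i))"
  proof (rule sum.cong[OF refl])
    fix i
    \<comment> \<open>The factor \<open>- \<i>\<close> of the measure cancels the \<i> of Cauchy's
      formula. The value is real, and the embedding of a real number does not depend on
      \<open>J\<close>.\<close>
    have "2 * pi * \<i> * of_real (slice_quot (F i) q) * - \<i> = of_real (2 * pi * slice_quot (F i) q)"
      by (simp add: algebra_simps)
    then show "L i (2 * pi * \<i> * of_real (slice_quot (F i) q)) = (2 * pi) *\<^sub>R (slice_quot (F i) q *\<^sub>R qe i)"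
      unfolding L_def by (simp only: embJ_of_real B(2) scaleR_scaleR)
  qed
  also have "\<dots> = (2 * pi) *\<^sub>R stem_quot \<alpha> \<beta> q"
    by (simp only: stem_quot_def F_def scaleR_sum_right)
  finally show ?thesis .
qed

lemma bdry_int_left_stem:
  assumes f: "\<And>u v J. J \<in> qsphere \<Longrightarrow> slice_pt u v J \<in> W \<Longrightarrow> f (slice_pt u v J) = \<alpha> (u, v) + J \<odot> \<beta> (u, v)"
    and J: "J \<in> qsphere" and cyc: "slice_cycle (slice_part W J) \<Gamma> q"
  shows "bdry_int_left \<Gamma> J f q = (2 * pi) *\<^sub>R stem_quot \<alpha> \<beta> q"
  unfolding bdry_int_left_def
proof (rule cycle_integral_stem[OF J cyc bounded_bilinear_qmult qreal_qmult(1)])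
  fix \<gamma> :: "real \<Rightarrow> complex" and t assume "\<gamma> t \<in> slice_part W J"
  then have "f (embJ J (\<gamma> t)) = \<alpha> (Re (\<gamma> t), Im (\<gamma> t)) + J \<odot> \<beta> (Re (\<gamma> t), Im (\<gamma> t))"
    using f[OF J] by (simp add: slice_part_def embJ_def)
  also have "\<dots> = (\<Sum>i<4. embJ J (stem_comp \<alpha> \<beta> i (\<gamma> t)) \<odot> qe i)"
    by (rule stem_comp_sum[OF bounded_bilinear_qmult qreal_qmult(1), symmetric])
  finally show "qinv (Qcs q (embJ J (\<gamma> t))) \<odot> (embJ J (vector_derivative \<gamma> (at t)) \<odot> - J) \<odot> f (embJ J (\<gamma> t))
      = (\<Sum>i<4. embJ J (inverse (slice_den q (\<gamma> t)) * (vector_derivative \<gamma> (at t) * - \<i>) * stem_comp \<alpha> \<beta> i (\<gamma> t)) \<odot> qe i)"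
    by (simp only: Qcs_embJ[OF J] qinv_embJ[OF J] embJ_mult[OF J] embJ_minus_ii qmult_assoc
        bounded_bilinear.sum_right[OF bounded_bilinear_qmult])
qed

lemma bdry_int_right_stem:
  assumes f: "\<And>u v J. J \<in> qsphere \<Longrightarrow> slice_pt u v J \<in> W \<Longrightarrow> f (slice_pt u v J) = \<alpha> (u, v) + \<beta> (u, v) \<odot> J"
    and J: "J \<in> qsphere" and cyc: "slice_cycle (slice_part W J) \<Gamma> q"
  shows "bdry_int_right \<Gamma> J f q = (2 * pi) *\<^sub>R stem_quot \<alpha> \<beta> q"
  unfolding bdry_int_right_def
proof (rule cycle_integral_stem[OF J cyc bounded_bilinear.flip[OF bounded_bilinear_qmult] qreal_qmult(2)])
  fix \<gamma> :: "real \<Rightarrow> complex" and t assume "\<gamma> t \<in> slice_part W J"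
  then have "f (embJ J (\<gamma> t)) = \<alpha> (Re (\<gamma> t), Im (\<gamma> t)) + \<beta> (Re (\<gamma> t), Im (\<gamma> t)) \<odot> J"
    using f[OF J] by (simp add: slice_part_def embJ_def)
  also have "\<dots> = (\<Sum>i<4. qe i \<odot> embJ J (stem_comp \<alpha> \<beta> i (\<gamma> t)))"
    by (rule stem_comp_sum[OF bounded_bilinear.flip[OF bounded_bilinear_qmult] qreal_qmult(2), symmetric])
  finally have "f (embJ J (\<gamma> t)) = (\<Sum>i<4. qe i \<odot> embJ J (stem_comp \<alpha> \<beta> i (\<gamma> t)))" .
  \<comment> \<open>The right-hand integral lists function, measure and kernel in the opposite
    order; within the slice the factors commute.\<close>
  moreover have "inverse (slice_den q (\<gamma> t)) * (vector_derivative \<gamma> (at t) * - \<i>) * stem_comp \<alpha> \<beta> i (\<gamma> t)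
      = stem_comp \<alpha> \<beta> i (\<gamma> t) * ((vector_derivative \<gamma> (at t) * - \<i>) * inverse (slice_den q (\<gamma> t)))" for i
    by (simp only: mult_ac)
  ultimately show "f (embJ J (\<gamma> t)) \<odot> (embJ J (vector_derivative \<gamma> (at t)) \<odot> - J) \<odot> qinv (Qcs q (embJ J (\<gamma> t)))
      = (\<Sum>i<4. qe i \<odot> embJ J (inverse (slice_den q (\<gamma> t)) * (vector_derivative \<gamma> (at t) * - \<i>) * stem_comp \<alpha> \<beta> i (\<gamma> t)))"
    by (simp only: Qcs_embJ[OF J] qinv_embJ[OF J] embJ_mult[OF J] embJ_minus_ii qmult_assoc
        bounded_bilinear.sum_left[OF bounded_bilinear_qmult])
qed

end

text \<open>The boundary lies in the closure of the slice of \<open>U\<close>, hence in the slice of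
  \<open>W\<close>. A point outside the latter is off that closure and has winding sum 0. Axial
  symmetry puts both conjugate representatives of \<open>q\<close> inside, where the sum is
  1.\<close>

lemma slice_cycle_boundary:
  assumes "open W" "open U" "axially_symmetric U" "closure U \<subseteq> W" "J \<in> qsphere"
    and \<Gamma>: "pos_oriented_boundary U J \<Gamma>" and "q \<in> U"
  shows "slice_cycle (slice_part W J) \<Gamma> q"
proof -
  let ?D = "slice_part U J"
  have D: "open ?D"
    using \<open>open U\<close> by (rule open_slice_part)
  have clD: "closure ?D \<subseteq> slice_part W J"
    using closure_slice_part[of U J] assms(4) by (auto simp: slice_part_def)
  have q: "slice_coord q \<in> ?D" "cnj (slice_coord q) \<in> ?D"
    using slice_coord_in_slice_part[OF assms(3,5)] slice_part_cnj[OF assms(3,5)] \<open>q \<in> U\<close> by auto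
  have fr: "z \<notin> frontier ?D" if "z \<in> ?D" for z
    using D that by (simp add: frontier_def interior_open)
  have images: "(\<Union>\<gamma>\<in>set \<Gamma>. path_image \<gamma>) = frontier ?D"
    and paths: "\<And>\<gamma>. \<gamma> \<in> set \<Gamma> \<Longrightarrow> valid_path \<gamma> \<and> pathfinish \<gamma> = pathstart \<gamma>"
    and winding: "\<And>z. z \<notin> frontier ?D \<Longrightarrow> (\<Sum>\<gamma>\<leftarrow>\<Gamma>. winding_number \<gamma> z) = (if z \<in> ?D then 1 else 0)"
    using \<Gamma> unfolding pos_oriented_boundary_def jordan_boundary_def by blast+
  show ?thesis
  proof
    show "open (slice_part W J)"
      using \<open>open W\<close> by (rule open_slice_part)
    show "slice_coord q \<in> slice_part W J" "cnj (slice_coord q) \<in> slice_part W J"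
      using q clD closure_subset by blast+
    show "(\<Sum>\<gamma>\<leftarrow>\<Gamma>. winding_number \<gamma> (slice_coord q)) = 1"
      "(\<Sum>\<gamma>\<leftarrow>\<Gamma>. winding_number \<gamma> (cnj (slice_coord q))) = 1"
      using winding fr q by auto
    show "(\<Sum>\<gamma>\<leftarrow>\<Gamma>. winding_number \<gamma> z) = 0" if "z \<notin> slice_part W J" for z
    proof -
      have "z \<notin> closure ?D"
        using that clD by blast
      then show ?thesis
        using winding[of z] closure_subset by (auto simp: frontier_def)
    qed
    show "valid_path \<gamma> \<and> pathfinish \<gamma> = pathstart \<gamma> \<and>
        path_image \<gamma> \<subseteq> slice_part W J - {slice_coord q, cnj (slice_coord q)}" if "\<gamma> \<in> set \<Gamma>" for \<gamma>
    proof -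
      have "path_image \<gamma> \<subseteq> frontier ?D"
        using images that by blast
      then have "path_image \<gamma> \<subseteq> slice_part W J - {slice_coord q, cnj (slice_coord q)}"
        using clD fr q by (auto simp: frontier_def)
      then show ?thesis
        using paths[OF that] by blast
    qed
  qed
qed

text \<open>Independence is expressed by the quantifiers: every admissible \<open>U\<close>,
  \<open>J\<close> and \<open>\<Gamma>\<close> give the same left-hand side. The constant is -2
  divided by 2 pi.\<close>

theorem theorem4p16:
  fixes W U :: "quat set" and f :: "quat \<Rightarrow> quat"
  assumes "open W" and "slice_cauchy_domain U" and "bounded U" and "closure U \<subseteq> W"
  shows "(left_slice_hh W f \<longrightarrow>
            harmonic_on W (fueter_left f) \<and>
            (\<forall>J\<in>qsphere. \<forall>\<Gamma>. pos_oriented_boundary U J \<Gamma> \<longrightarrow>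
               (\<forall>q\<in>U. fueter_left f q = (- 1 / pi) *\<^sub>R bdry_int_left \<Gamma> J f q)))
       \<and> (right_slice_hh W f \<longrightarrow>
            harmonic_on W (fueter_right f) \<and>
            (\<forall>J\<in>qsphere. \<forall>\<Gamma>. pos_oriented_boundary U J \<Gamma> \<longrightarrow>
               (\<forall>q\<in>U. fueter_right f q = (- 1 / pi) *\<^sub>R bdry_int_right \<Gamma> J f q)))"
proof (intro conjI impI)
  have U: "open U" "axially_symmetric U"
    using assms(2) by (auto simp: slice_cauchy_domain_def)
  have UW: "q \<in> W" if "q \<in> U" for q
    using that assms(4) closure_subset by blast
  have harmonic: "harmonic_on W g" if "slice_stem W \<alpha> \<beta>" "\<And>q. q \<in> W \<Longrightarrow> g q = (-2) *\<^sub>R stem_quot \<alpha> \<beta> q" for g \<alpha> \<beta>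
  proof (rule harmonic_on_local)
    fix q assume "q \<in> W"
    then show "\<exists>V h. open V \<and> q \<in> V \<and> (\<forall>x\<in>V. g x = h x) \<and> harmonic_on V h"
      using slice_stem.harmonic_stem_quot[OF that(1), of "-2"] that(2) assms(1)
      by (intro exI[of _ W] exI[of _ "\<lambda>q. (-2) *\<^sub>R stem_quot \<alpha> \<beta> q"] conjI ballI)
  qed
  {
    assume "left_slice_hh W f"
    then obtain \<alpha> \<beta> where st: "slice_stem W \<alpha> \<beta>" and f: "\<And>u v J. J \<in> qsphere \<Longrightarrow> slice_pt u v J \<in> W \<Longrightarrow>
        f (slice_pt u v J) = \<alpha> (u, v) + J \<odot> \<beta> (u, v)"
      unfolding left_slice_hh_def slice_stem_def by blast
    note D = slice_stem.fueter_left_stem[OF st f]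
    show "harmonic_on W (fueter_left f)"
      by (rule harmonic[OF st D])
    show "\<forall>J\<in>qsphere. \<forall>\<Gamma>. pos_oriented_boundary U J \<Gamma> \<longrightarrow>
        (\<forall>q\<in>U. fueter_left f q = (- 1 / pi) *\<^sub>R bdry_int_left \<Gamma> J f q)"
    proof (intro ballI allI impI)
      fix J \<Gamma> q assume J: "J \<in> qsphere" "pos_oriented_boundary U J \<Gamma>" "q \<in> U"
      have "bdry_int_left \<Gamma> J f q = (2 * pi) *\<^sub>R stem_quot \<alpha> \<beta> q"
        by (rule slice_stem.bdry_int_left_stem[OF st f J(1) slice_cycle_boundary[OF assms(1) U assms(4) J]])
      moreover have "fueter_left f q = (-2) *\<^sub>R stem_quot \<alpha> \<beta> q"
        by (rule D[OF _ _ UW[OF J(3)]])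
      ultimately show "fueter_left f q = (- 1 / pi) *\<^sub>R bdry_int_left \<Gamma> J f q"
        by simp
    qed
  next
    assume "right_slice_hh W f"
    then obtain \<alpha> \<beta> where st: "slice_stem W \<alpha> \<beta>" and f: "\<And>u v J. J \<in> qsphere \<Longrightarrow> slice_pt u v J \<in> W \<Longrightarrow>
        f (slice_pt u v J) = \<alpha> (u, v) + \<beta> (u, v) \<odot> J"
      unfolding right_slice_hh_def slice_stem_def by blast
    note D = slice_stem.fueter_right_stem[OF st f]
    show "harmonic_on W (fueter_right f)"
      by (rule harmonic[OF st D])
    show "\<forall>J\<in>qsphere. \<forall>\<Gamma>. pos_oriented_boundary U J \<Gamma> \<longrightarrow>
        (\<forall>q\<in>U. fueter_right f q = (- 1 / pi) *\<^sub>R bdry_int_right \<Gamma> J f q)"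
    proof (intro ballI allI impI)
      fix J \<Gamma> q assume J: "J \<in> qsphere" "pos_oriented_boundary U J \<Gamma>" "q \<in> U"
      have "bdry_int_right \<Gamma> J f q = (2 * pi) *\<^sub>R stem_quot \<alpha> \<beta> q"
        by (rule slice_stem.bdry_int_right_stem[OF st f J(1) slice_cycle_boundary[OF assms(1) U assms(4) J]])
      moreover have "fueter_right f q = (-2) *\<^sub>R stem_quot \<alpha> \<beta> q"
        by (rule D[OF _ _ UW[OF J(3)]])
      ultimately show "fueter_right f q = (- 1 / pi) *\<^sub>R bdry_int_right \<Gamma> J f q"
        by simp
    qed
  }
qed

end
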